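(* Let $d$ be a positive integer. If $\mathbf{k}$ is a left-noetherian ring then $\mathrm{Rep}_{\mathbf{k}}(\mathbf{FI}_d)$ is noetherian.
   Context: $\mathbf{FI}_d$ is the category whose objects are finite sets; a morphism $S\to T$ is a pair $(f,g)$ with $f\colon S\to T$ an injection and $g\colon T\setminus f(S)\to\{1,\dots,d\}$ a function. The composite of $(f,g)\colon S\to T$ and $(f',g')\colon T\to U$ is $(f'f,g'')$ where $g''=g'$ on $U\setminus f'(T)$ and $g''(f'(t))=g(t)$ for $t\in T\setminus f(S)$. $\mathrm{Rep}_{\mathbf{k}}(\mathcal{C})$ is the category of functors from $\mathcal{C}$ to left $\mathbf{k}$-modules. Such a functor $M$ is finitely generated if there is a finite set of elements (each in some $M(x)$) such that $M$ is the smallest subrepresentation containing them. $\mathrm{Rep}_{\mathbf{k}}(\mathcal{C})$ is noetherian if every subrepresentation of a finitely generated representation is finitely generated. *)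

theory Defs
  imports "HOL-Algebra.Algebra" "HOL-Library.Infinite_Typeclass"
begin

section \<open>Left modules and left-noetherian rings\<close>

text \<open>The locale \<^locale>\<open>module\<close> requires a commutative ring of scalars, and the locale
  \<^locale>\<open>noetherian_ring\<close> speaks about two-sided ideals; hence one-sided versions are needed.
  The locale \<^locale>\<open>submodule\<close> makes no commutativity assumption and is used as it is.\<close>

locale left_module = R?: ring R + M?: abelian_group M
  for R :: "('k, 'r) ring_scheme" (structure) and M :: "('k, 'm, 's) module_scheme" (structure) +
  assumes smult_closed:
      "\<lbrakk>a \<in> carrier R; x \<in> carrier M\<rbrakk> \<Longrightarrow> a \<odot>\<^bsub>M\<^esub> x \<in> carrier M"
    and smult_l_distr:
      "\<lbrakk>a \<in> carrier R; b \<in> carrier R; x \<in> carrier M\<rbrakk> \<Longrightarrow>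
        (a \<oplus> b) \<odot>\<^bsub>M\<^esub> x = a \<odot>\<^bsub>M\<^esub> x \<oplus>\<^bsub>M\<^esub> b \<odot>\<^bsub>M\<^esub> x"
    and smult_r_distr:
      "\<lbrakk>a \<in> carrier R; x \<in> carrier M; y \<in> carrier M\<rbrakk> \<Longrightarrow>
        a \<odot>\<^bsub>M\<^esub> (x \<oplus>\<^bsub>M\<^esub> y) = a \<odot>\<^bsub>M\<^esub> x \<oplus>\<^bsub>M\<^esub> a \<odot>\<^bsub>M\<^esub> y"
    and smult_assoc1:
      "\<lbrakk>a \<in> carrier R; b \<in> carrier R; x \<in> carrier M\<rbrakk> \<Longrightarrow>
        (a \<otimes> b) \<odot>\<^bsub>M\<^esub> x = a \<odot>\<^bsub>M\<^esub> (b \<odot>\<^bsub>M\<^esub> x)"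
    and smult_one:
      "x \<in> carrier M \<Longrightarrow> \<one> \<odot>\<^bsub>M\<^esub> x = x"

definition left_module_hom ::
    "('k, 'r) ring_scheme \<Rightarrow> ('k, 'm) module \<Rightarrow> ('k, 'm) module \<Rightarrow> ('m \<Rightarrow> 'm) set" where
  "left_module_hom R M N = {h \<in> carrier M \<rightarrow> carrier N.
     (\<forall>x\<in>carrier M. \<forall>y\<in>carrier M. h (x \<oplus>\<^bsub>M\<^esub> y) = h x \<oplus>\<^bsub>N\<^esub> h y) \<and>
     (\<forall>a\<in>carrier R. \<forall>x\<in>carrier M. h (a \<odot>\<^bsub>M\<^esub> x) = a \<odot>\<^bsub>N\<^esub> h x)}"

locale left_ideal = additive_subgroup I R + ring R for I and R (structure) +
  assumes I_l_closed: "\<lbrakk>a \<in> I; x \<in> carrier R\<rbrakk> \<Longrightarrow> x \<otimes> a \<in> I"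

definition gen_left_ideal :: "('k, 'r) ring_scheme \<Rightarrow> 'k set \<Rightarrow> 'k set" where
  "gen_left_ideal R A = \<Inter>{I. left_ideal I R \<and> A \<subseteq> I}"

locale left_noetherian_ring = ring +
  assumes finitely_gen:
    "left_ideal I R \<Longrightarrow> \<exists>A \<subseteq> carrier R. finite A \<and> I = gen_left_ideal R A"


section \<open>Categories\<close>

text \<open>Hom sets are indexed by source and target and need not be disjoint, so all operations take
  the objects involved as arguments. In particular \<open>Comp C x y z g f\<close> is the composite
  of \<open>f \<in> Hom C x y\<close> followed by \<open>g \<in> Hom C y z\<close>.\<close>

record ('o, 'f) category =
  Obj :: "'o set"
  Hom :: "'o \<Rightarrow> 'o \<Rightarrow> 'f set"
  Ident :: "'o \<Rightarrow> 'f"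
  Comp :: "'o \<Rightarrow> 'o \<Rightarrow> 'o \<Rightarrow> 'f \<Rightarrow> 'f \<Rightarrow> 'f"

locale category =
  fixes C :: "('o, 'f) category"
  assumes Ident_closed: "x \<in> Obj C \<Longrightarrow> Ident C x \<in> Hom C x x"
    and Comp_closed:
      "\<lbrakk>x \<in> Obj C; y \<in> Obj C; z \<in> Obj C; f \<in> Hom C x y; g \<in> Hom C y z\<rbrakk> \<Longrightarrow>
        Comp C x y z g f \<in> Hom C x z"
    and Comp_Ident_right:
      "\<lbrakk>x \<in> Obj C; y \<in> Obj C; f \<in> Hom C x y\<rbrakk> \<Longrightarrow> Comp C x x y f (Ident C x) = f"
    and Comp_Ident_left:
      "\<lbrakk>x \<in> Obj C; y \<in> Obj C; f \<in> Hom C x y\<rbrakk> \<Longrightarrow> Comp C x y y (Ident C y) f = f"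
    and Comp_assoc:
      "\<lbrakk>w \<in> Obj C; x \<in> Obj C; y \<in> Obj C; z \<in> Obj C;
        f \<in> Hom C w x; g \<in> Hom C x y; h \<in> Hom C y z\<rbrakk> \<Longrightarrow>
        Comp C w x z (Comp C x y z h g) f = Comp C w y z h (Comp C w x y g f)"


section \<open>Representations of a category\<close>

record ('o, 'f, 'k, 'm) rep =
  ObjMap :: "'o \<Rightarrow> ('k, 'm) module"
  ArrMap :: "'o \<Rightarrow> 'o \<Rightarrow> 'f \<Rightarrow> 'm \<Rightarrow> 'm"

text \<open>Functors to left modules. Maps between modules matter only on the carriers, so the functor
  laws are equations on carriers.\<close>

locale representation = R?: ring R + category C
  for R :: "('k, 'r) ring_scheme" (structure) and C :: "('o, 'f) category" +
  fixes M :: "('o, 'f, 'k, 'm) rep"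
  assumes ObjMap_module: "x \<in> Obj C \<Longrightarrow> left_module R (ObjMap M x)"
    and ArrMap_hom:
      "\<lbrakk>x \<in> Obj C; y \<in> Obj C; f \<in> Hom C x y\<rbrakk> \<Longrightarrow>
        ArrMap M x y f \<in> left_module_hom R (ObjMap M x) (ObjMap M y)"
    and ArrMap_Ident:
      "\<lbrakk>x \<in> Obj C; v \<in> carrier (ObjMap M x)\<rbrakk> \<Longrightarrow> ArrMap M x x (Ident C x) v = v"
    and ArrMap_Comp:
      "\<lbrakk>x \<in> Obj C; y \<in> Obj C; z \<in> Obj C; f \<in> Hom C x y; g \<in> Hom C y z;
        v \<in> carrier (ObjMap M x)\<rbrakk> \<Longrightarrow>
        ArrMap M x z (Comp C x y z g f) v = ArrMap M y z g (ArrMap M x y f v)"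

definition subrep ::
    "('k, 'r) ring_scheme \<Rightarrow> ('o, 'f) category \<Rightarrow> ('o, 'f, 'k, 'm) rep \<Rightarrow> ('o \<Rightarrow> 'm set) \<Rightarrow> bool" where
  "subrep R C M N \<longleftrightarrow>
     (\<forall>x\<in>Obj C. submodule (N x) R (ObjMap M x)) \<and>
     (\<forall>x\<in>Obj C. \<forall>y\<in>Obj C. \<forall>f\<in>Hom C x y. ArrMap M x y f ` N x \<subseteq> N y)"

definition restrict_rep ::
    "('o, 'f, 'k, 'm) rep \<Rightarrow> ('o \<Rightarrow> 'm set) \<Rightarrow> ('o, 'f, 'k, 'm) rep" where
  "restrict_rep M N = M\<lparr>ObjMap := (\<lambda>x. (ObjMap M x)\<lparr>carrier := N x\<rparr>)\<rparr>"

text \<open>An element of a representation is a pair of an object \<open>x\<close> and an element of the module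
  at \<open>x\<close>.\<close>

definition rep_elements :: "('o, 'f) category \<Rightarrow> ('o, 'f, 'k, 'm) rep \<Rightarrow> ('o \<times> 'm) set" where
  "rep_elements C M = (SIGMA x:Obj C. carrier (ObjMap M x))"

definition smallest_subrep ::
    "('k, 'r) ring_scheme \<Rightarrow> ('o, 'f) category \<Rightarrow> ('o, 'f, 'k, 'm) rep \<Rightarrow> ('o \<times> 'm) set
      \<Rightarrow> ('o \<Rightarrow> 'm set) \<Rightarrow> bool" where
  "smallest_subrep R C M A N \<longleftrightarrow>
     subrep R C M N \<and> (\<forall>(x, v)\<in>A. v \<in> N x) \<and>
     (\<forall>N'. subrep R C M N' \<and> (\<forall>(x, v)\<in>A. v \<in> N' x) \<longrightarrow> (\<forall>x\<in>Obj C. N x \<subseteq> N' x))"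

definition finitely_generated_rep ::
    "('k, 'r) ring_scheme \<Rightarrow> ('o, 'f) category \<Rightarrow> ('o, 'f, 'k, 'm) rep \<Rightarrow> bool" where
  "finitely_generated_rep R C M \<longleftrightarrow>
     (\<exists>A. finite A \<and> A \<subseteq> rep_elements C M \<and>
          smallest_subrep R C M A (\<lambda>x. carrier (ObjMap M x)))"

text \<open>The last argument only fixes the type that holds the elements of the modules.\<close>

definition Rep_noetherian ::
    "('k, 'r) ring_scheme \<Rightarrow> ('o, 'f) category \<Rightarrow> 'm itself \<Rightarrow> bool" where
  "Rep_noetherian R C _ \<longleftrightarrow>
     (\<forall>M :: ('o, 'f, 'k, 'm) rep. representation R C M \<and> finitely_generated_rep R C M \<longrightarrow>
        (\<forall>N. subrep R C M N \<longrightarrow> finitely_generated_rep R C (restrict_rep M N)))"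

lemma (in left_module) submodule_left_module:
  assumes "submodule H R M"
  shows "left_module R (M\<lparr>carrier := H\<rparr>)"
proof -
  interpret H: submodule H R M by fact
  have sub: "H \<subseteq> carrier M"
    using H.subset by simp
  have grp: "group (add_monoid M)"
    by (rule a_group)
  have "comm_group ((add_monoid M)\<lparr>carrier := H\<rparr>)"
  proof (rule group.group_comm_groupI)
    show "group ((add_monoid M)\<lparr>carrier := H\<rparr>)"
      by (rule H.subgroup_is_group[OF grp])
  qed (use sub a_comm in auto)
  then have "abelian_group (M\<lparr>carrier := H\<rparr>)"
    by (auto simp: abelian_group_def abelian_monoid_def abelian_group_axioms_def comm_group_def)
  then show ?thesis
    unfolding left_module_def left_module_axioms_def
    using sub R.ring_axioms
    by (auto simp: smult_l_distr smult_r_distr smult_assoc1 smult_one subset_iff)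
qed

lemma (in representation) representation_restrict_rep:
  assumes "subrep R C M N"
  shows "representation R C (restrict_rep M N)"
proof -
  have N: "submodule (N x) R (ObjMap M x)" if "x \<in> Obj C" for x
    using assms that by (auto simp: subrep_def)
  have sub: "N x \<subseteq> carrier (ObjMap M x)" if "x \<in> Obj C" for x
    using subgroup.subset[OF submodule.axioms(1)[OF N[OF that]]] by simp
  have maps: "ArrMap M x y f v \<in> N y"
    if "x \<in> Obj C" "y \<in> Obj C" "f \<in> Hom C x y" "v \<in> N x" for x y f v
    using assms that unfolding subrep_def by blast
  show ?thesis
  proof (intro representation.intro representation_axioms.intro R.ring_axioms category_axioms,
      goal_cases)
    case (1 x)
    then show ?case
      using left_module.submodule_left_module[OF ObjMap_module N]
      by (simp add: restrict_rep_def)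
  next
    case (2 x y f)
    then show ?case
      using ArrMap_hom[OF 2] sub[of x] maps[OF 2]
      by (auto simp: restrict_rep_def left_module_hom_def subset_iff)
  next
    case (3 x v)
    then show ?case
      using sub[of x] ArrMap_Ident by (auto simp: restrict_rep_def)
  next
    case (4 x y z f g v)
    then show ?case
      using sub[of x] ArrMap_Comp by (auto simp: restrict_rep_def)
  qed
qed


section \<open>The category \<open>FI\<^sub>d\<close>\<close>

text \<open>The objects are the finite subsets of an arbitrary infinite type, so every finite set is
  in bijection with an object. Functions are taken extensional on their domain, so
  that equality of morphisms is equality of functions on the stated domains.\<close>

definition FI_hom :: "nat \<Rightarrow> 'x set \<Rightarrow> 'x set \<Rightarrow> (('x \<Rightarrow> 'x) \<times> ('x \<Rightarrow> nat)) set" where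
  "FI_hom d S T = {(f, g). f \<in> S \<rightarrow>\<^sub>E T \<and> inj_on f S \<and> g \<in> (T - f ` S) \<rightarrow>\<^sub>E {1..d}}"

definition FI_comp ::
    "'x set \<Rightarrow> 'x set \<Rightarrow> 'x set \<Rightarrow> ('x \<Rightarrow> 'x) \<times> ('x \<Rightarrow> nat) \<Rightarrow> ('x \<Rightarrow> 'x) \<times> ('x \<Rightarrow> nat)
      \<Rightarrow> ('x \<Rightarrow> 'x) \<times> ('x \<Rightarrow> nat)" where
  "FI_comp S T U = (\<lambda>(f', g') (f, g).
     (compose S f' f,
      \<lambda>u\<in>U - f' ` f ` S. if u \<in> f' ` T then g (the_inv_into T f' u) else g' u))"

definition FI :: "nat \<Rightarrow> ('x::infinite set, ('x \<Rightarrow> 'x) \<times> ('x \<Rightarrow> nat)) category" where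
  "FI d = \<lparr>Obj = {S. finite S},
           Hom = FI_hom d,
           Ident = (\<lambda>S. (\<lambda>s\<in>S. s, \<lambda>_\<in>{}. undefined)),
           Comp = FI_comp\<rparr>"

lemma FI_comp_closed:
  assumes "\<phi> \<in> FI_hom d S T" "\<psi> \<in> FI_hom d T U"
  shows "FI_comp S T U \<psi> \<phi> \<in> FI_hom d S U"
proof -
  obtain f g f' g' where [simp]: "\<phi> = (f, g)" "\<psi> = (f', g')"
    by (cases \<phi>, cases \<psi>) auto
  have f: "f \<in> S \<rightarrow>\<^sub>E T" "inj_on f S" "g \<in> (T - f ` S) \<rightarrow>\<^sub>E {1..d}"
    and f': "f' \<in> T \<rightarrow>\<^sub>E U" "inj_on f' T" "g' \<in> (U - f' ` T) \<rightarrow>\<^sub>E {1..d}"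
    using assms by (auto simp: FI_hom_def)
  have im: "compose S f' f ` S = f' ` f ` S"
    by (auto simp: compose_def)
  have "compose S f' f \<in> S \<rightarrow>\<^sub>E U"
    using f(1) f'(1) by (auto simp: compose_def)
  moreover have "inj_on (compose S f' f) S"
    using f f' by (auto simp: inj_on_def compose_def PiE_iff)
  moreover have "(\<lambda>u\<in>U - f' ` f ` S. if u \<in> f' ` T then g (the_inv_into T f' u) else g' u)
      \<in> (U - f' ` f ` S) \<rightarrow>\<^sub>E {1..d}"
  proof (rule restrict_PiE_iff[THEN iffD2], rule ballI)
    fix u assume u: "u \<in> U - f' ` f ` S"
    show "(if u \<in> f' ` T then g (the_inv_into T f' u) else g' u) \<in> {1..d}"
    proof (cases "u \<in> f' ` T")
      case True
      then obtain t where t: "t \<in> T" "u = f' t" by auto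
      with u have "t \<in> T - f ` S" by auto
      then show ?thesis
        using t f(3) f'(2) by (auto simp: the_inv_into_f_f PiE_iff)
    next
      case False
      then show ?thesis using u f'(3) by (auto simp: PiE_iff)
    qed
  qed
  ultimately show ?thesis
    by (simp add: FI_hom_def FI_comp_def im)
qed

lemma FI_comp_assoc:
  assumes "\<phi> \<in> FI_hom d S T" "\<psi> \<in> FI_hom d T U" "\<chi> \<in> FI_hom d U V"
  shows "FI_comp S T V (FI_comp T U V \<chi> \<psi>) \<phi> = FI_comp S U V \<chi> (FI_comp S T U \<psi> \<phi>)"
proof -
  obtain f g f' g' f'' g'' where [simp]: "\<phi> = (f, g)" "\<psi> = (f', g')" "\<chi> = (f'', g'')"
    by (cases \<phi>, cases \<psi>, cases \<chi>) auto
  have f: "\<And>s. s \<in> S \<Longrightarrow> f s \<in> T"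
    and f': "\<And>t. t \<in> T \<Longrightarrow> f' t \<in> U" "inj_on f' T"
    and f'': "inj_on f'' U"
    using assms by (auto simp: FI_hom_def)
  have ims: "compose S f' f ` S = f' ` f ` S" "compose T f'' f' ` T = f'' ` f' ` T"
    "compose T f'' f' ` f ` S = f'' ` f' ` f ` S"
    using f by (auto simp: compose_def image_iff)
  have inj: "inj_on (compose T f'' f') T"
    using f' f'' by (auto simp: inj_on_def compose_def)
  have "compose S (compose T f'' f') f = compose S f'' (compose S f' f)"
    using f by (auto simp: compose_def fun_eq_iff)
  moreover have
    "(if v \<in> f'' ` f' ` T then g (the_inv_into T (compose T f'' f') v)
      else (\<lambda>u\<in>V - f'' ` f' ` T. if u \<in> f'' ` U then g' (the_inv_into U f'' u) else g'' u) v)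
     = (if v \<in> f'' ` U
        then (\<lambda>u\<in>U - f' ` f ` S. if u \<in> f' ` T then g (the_inv_into T f' u) else g' u)
               (the_inv_into U f'' v)
        else g'' v)"
    if v: "v \<in> V - f'' ` f' ` f ` S" for v
  proof (cases "v \<in> f'' ` U")
    case False
    then show ?thesis using v f' by auto
  next
    case True
    then obtain u where u: "u \<in> U" "v = f'' u" by auto
    have iu: "the_inv_into U f'' v = u"
      using u f'' by (simp add: the_inv_into_f_f)
    show ?thesis
    proof (cases "u \<in> f' ` T")
      case True
      then obtain t where t: "t \<in> T" "u = f' t" by auto
      have "the_inv_into T (compose T f'' f') v = t"
        using the_inv_into_f_f[OF inj t(1)] t u by (simp add: compose_def)
      moreover have "u \<notin> f' ` f ` S" using u v by auto
      ultimately show ?thesis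
        using t u f' iu by (auto simp: the_inv_into_f_f)
    next
      case False
      have "v \<notin> f'' ` f' ` T"
        using False u f'(1) f'' by (auto simp: inj_on_def)
      moreover have "u \<notin> f' ` f ` S" using u v by auto
      ultimately show ?thesis
        using False u v iu by auto
    qed
  qed
  ultimately show ?thesis
    by (simp add: FI_comp_def ims cong: restrict_cong)
qed

lemma category_FI: "category (FI d)"
proof (unfold_locales, goal_cases)
  case (1 S)
  show ?case by (auto simp: FI_def FI_hom_def inj_on_def)
next
  case (2 S T U \<phi> \<psi>)
  then show ?case using FI_comp_closed[of \<phi> d S T \<psi> U] by (simp add: FI_def)
next
  case (3 S T \<phi>)
  obtain f g where [simp]: "\<phi> = (f, g)" by (cases \<phi>)
  have f: "f \<in> extensional S" "g \<in> extensional (T - f ` S)" "inj_on f S"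
    using 3 by (auto simp: FI_def FI_hom_def PiE_iff)
  have "compose S f (\<lambda>s\<in>S. s) = f"
    using f by (auto simp: compose_def fun_eq_iff extensional_def)
  moreover have "(\<lambda>u\<in>T - f ` S. if u \<in> f ` S then c u else g u) = g" for c
    using f by (auto simp: fun_eq_iff extensional_def)
  ultimately show ?case
    by (simp add: FI_def FI_comp_def)
next
  case (4 S T \<phi>)
  obtain f g where [simp]: "\<phi> = (f, g)" by (cases \<phi>)
  have f: "f \<in> extensional S" "g \<in> extensional (T - f ` S)" "\<And>s. s \<in> S \<Longrightarrow> f s \<in> T"
    using 4 by (auto simp: FI_def FI_hom_def PiE_iff)
  have im: "(\<lambda>t\<in>T. t) ` f ` S = f ` S" "(\<lambda>t\<in>T. t) ` T = T"
    using f(3) by (auto simp: image_iff)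
  have inv: "the_inv_into T (\<lambda>t\<in>T. t) u = u" if "u \<in> T" for u
    using the_inv_into_f_f[of "\<lambda>t\<in>T. t" T u] that by (auto simp: inj_on_def)
  have "compose S (\<lambda>t\<in>T. t) f = f"
    using f by (auto simp: compose_def fun_eq_iff extensional_def)
  moreover have "(\<lambda>u\<in>T - f ` S. if u \<in> T then g (the_inv_into T (\<lambda>t\<in>T. t) u) else c u) = g" for c
    using f inv by (auto simp: fun_eq_iff extensional_def)
  ultimately show ?case
    by (simp only: FI_def category.simps FI_comp_def prod.case im \<open>\<phi> = (f, g)\<close>)
next
  case (5 S T U V \<phi> \<psi> \<chi>)
  then show ?case using FI_comp_assoc by (simp add: FI_def)
qed

end

theory Submission
  imports Defs "HOL-Library.Sublist"
begin

text \<open>This is a Groebner basis argument in the style of Sam and Snowden. Let \<open>M\<close> be generated by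
  finitely many \<open>v \<in> M(S)\<close>. Up to isomorphism objects are initial segments of the natural numbers,
  and morphisms from \<open>S\<close> to them are words in the finite alphabet \<open>S \<union> {1..d}\<close>. By Higman's lemma
  these words are well-quasi-ordered by the subword relation; for two words of the same \<open>S\<close> this
  relation means that one morphism factors through the other by an order-preserving one, and such
  factors respect the lexicographic order. Hence leading terms of elements of a
  subrepresentation behave as in Hilbert's basis theorem.\<close>

text \<open>Two obstacles shape the argument. The images of the generators may satisfy relations, so
  a vector of \<open>M\<close> has no well-defined leading term. Rather than passing to a free
  cover, leading at an index is treated as a relation between vectors, indices and coefficients. The
  contradiction comes from a choice of minimal index, and for this it is harmless that one vector
  may lead at several indices. Secondly, general morphisms, permutations for instance, do not
  respect the lexicographic order. Indices are therefore compared only along order-preserving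
  morphisms between initial segments, and the remaining objects are reached through an isomorphism
  with a segment of the same size.\<close>

section \<open>Higman's lemma over a finite alphabet\<close>

lemma infinite_sequence_constant_subsequence:
  fixes s :: "nat \<Rightarrow> 'a"
  assumes "finite A" and "range s \<subseteq> A"
  obtains k c where "strict_mono (k :: nat \<Rightarrow> nat)" "\<And>n. s (k n) = c"
proof -
  have "finite (range s)"
    using assms finite_subset by blast
  then obtain c where "infinite {n. s n = s c}"
    using inf_img_fin_domE[of s UNIV] by (auto simp: vimage_def)
  then show thesis
    using that[of "enumerate {n. s n = s c}" "s c"] enumerate_in_set[of "{n. s n = s c}"]
    by (auto simp: strict_mono_enumerate)
qed

lemma Higman_finite_alphabet:
  assumes "finite A" and "range s \<subseteq> lists A"
  obtains i j where "(i :: nat) < j" "subseq (s i) (s j)"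
proof (rule ccontr)
  define bad where
    "bad f \<longleftrightarrow> range f \<subseteq> lists A \<and> (\<forall>i j. i < j \<longrightarrow> \<not> subseq (f i) (f j))"
    for f :: "nat \<Rightarrow> 'a list"
  \<comment> \<open>Nash-Williams' minimal bad sequence argument\<close>
  define minim where
    "minim n f \<longleftrightarrow> bad f \<and> (\<forall>h. bad h \<and> (\<forall>i<n. h i = f i) \<longrightarrow> length (f n) \<le> length (h n))"
    for n f
  assume "\<not> thesis"
  then have "bad s"
    using that assms(2) by (auto simp: bad_def)
  have minim_ex: "\<exists>g. minim n g \<and> (\<forall>i<n. g i = f i)" if "bad f" for n f
  proof -
    obtain g where g: "bad g \<and> (\<forall>i<n. g i = f i)"
      "\<And>h. bad h \<and> (\<forall>i<n. h i = f i) \<Longrightarrow> length (g n) \<le> length (h n)"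
      using ex_has_least_nat[of "\<lambda>g. bad g \<and> (\<forall>i<n. g i = f i)" f "\<lambda>g. length (g n)"]
        \<open>bad f\<close> by blast
    then show ?thesis
      by (intro exI[of _ g]) (simp add: minim_def)
  qed
  \<comment> \<open>\<open>G n\<close> is as short as possible at position \<open>n\<close>, and
    later sequences leave the positions up to \<open>n\<close> unchanged. So the diagonal
    \<open>m\<close> agrees with \<open>G n\<close> up to position \<open>n\<close>.\<close>
  obtain G where G: "\<And>n. minim n (G n)" "\<And>n. \<forall>i\<le>n. G (Suc n) i = G n i"
    using dependent_nat_choice[of minim "\<lambda>n g g'. \<forall>i\<le>n. g' i = g i"] minim_ex \<open>bad s\<close>
    by (metis less_Suc_eq_le minim_def)
  define m where "m n = G n n" for n
  have G_m: "G n i = m i" if "i \<le> n" for i n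
    using that by (induction rule: dec_induct) (auto simp: G(2) m_def)
  have m_lists: "range m \<subseteq> lists A"
    using G(1) unfolding minim_def bad_def m_def by blast
  have m_bad: "\<not> subseq (m i) (m j)" if "i < j" for i j
    using G(1)[of j] that G_m[of i j] G_m[of j j] unfolding minim_def bad_def
    by (metis less_imp_le order_refl)
  have m_ne: "m i \<noteq> []" for i
    using m_bad[of i "Suc i"] by auto
  have m_A: "set (m i) \<subseteq> A" for i
    using m_lists by (auto simp: lists_eq_set)
  then have "range (\<lambda>i. hd (m i)) \<subseteq> A"
    using hd_in_set[OF m_ne] by blast
  then obtain k :: "nat \<Rightarrow> nat" and c where k: "strict_mono k" "\<And>n. hd (m (k n)) = c"
    by (rule infinite_sequence_constant_subsequence[OF assms(1)]) blast
  have m_k: "m (k n) = c # tl (m (k n))" for n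
    using list.collapse[OF m_ne, of "k n"] by (simp add: k(2))
  \<comment> \<open>Follow \<open>m\<close> before \<open>k 0\<close>, then continue with the words
    starting with \<open>c\<close>, stripped of that letter. A pair in \<open>h\<close> violating
    badness would give one in \<open>m\<close>: prepend \<open>c\<close> to both words, or use that
    a tail embeds in its word. But \<open>h\<close> is shorter than \<open>m\<close> at
    \<open>k 0\<close>, against minimality.\<close>
  define h where "h i = (if i < k 0 then m i else tl (m (k (i - k 0))))" for i
  have "bad h"
    unfolding bad_def
  proof (intro conjI allI impI)
    have "set (tl (m (k i))) \<subseteq> set (m (k i))" for i
      by (subst (2) m_k) auto
    then have "set (h i) \<subseteq> A" for i
      using m_A by (auto simp: h_def)
    then show "range h \<subseteq> lists A"
      by (auto simp: lists_eq_set)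
  next
    fix i j :: nat
    assume "i < j"
    consider "j < k 0" | "i < k 0" "k 0 \<le> j" | "k 0 \<le> i"
      by linarith
    then show "\<not> subseq (h i) (h j)"
    proof cases
      case 1
      then show ?thesis using \<open>i < j\<close> m_bad by (simp add: h_def)
    next
      case 2
      have "k 0 \<le> k (j - k 0)"
        using k(1) by (simp add: strict_mono_less_eq)
      then have "\<not> subseq (m i) (m (k (j - k 0)))"
        using 2 m_bad by simp
      moreover have "subseq (tl (m (k (j - k 0)))) (m (k (j - k 0)))"
        by (subst (2) m_k) auto
      ultimately show ?thesis
        using 2 subseq_order.order_trans by (auto simp: h_def)
    next
      case 3
      then have "k (i - k 0) < k (j - k 0)"
        using k(1) \<open>i < j\<close> by (simp add: strict_mono_less diff_less_mono)
      then have "\<not> subseq (m (k (i - k 0))) (m (k (j - k 0)))"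
        using m_bad by blast
      then have "\<not> subseq (tl (m (k (i - k 0)))) (tl (m (k (j - k 0))))"
        by (metis m_k subseq_Cons2)
      then show ?thesis
        using 3 \<open>i < j\<close> by (simp add: h_def)
    qed
  qed
  moreover have "\<forall>i<k 0. h i = G (k 0) i"
    by (simp add: h_def G_m)
  ultimately have "length (G (k 0) (k 0)) \<le> length (h (k 0))"
    using G(1) unfolding minim_def by blast
  moreover have "length (h (k 0)) = length (m (k 0)) - 1"
    by (simp add: h_def)
  moreover have "G (k 0) (k 0) = m (k 0)"
    by (simp add: m_def)
  moreover have "0 < length (m (k 0))"
    using m_ne by simp
  ultimately show False
    by (metis diff_less less_one not_less)
qed

text \<open>Infinitely many words that embed in no later word would form a bad sequence. Beyond the
  last such word every word embeds in a later one, so a chain can be prolonged forever.\<close>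

lemma Higman_finite_alphabet_chain:
  assumes "finite A" and s: "range s \<subseteq> lists A"
  obtains k :: "nat \<Rightarrow> nat"
  where "strict_mono k" "\<And>i j. i < j \<Longrightarrow> subseq (s (k i)) (s (k j))"
proof -
  define T where "T = {i. \<forall>j>i. \<not> subseq (s i) (s j)}"
  have "finite T"
  proof (rule ccontr)
    assume T: "infinite T"
    define t where "t = enumerate T"
    have "range (s \<circ> t) \<subseteq> lists A"
      using s by auto
    then obtain i j where "i < j" "subseq ((s \<circ> t) i) ((s \<circ> t) j)"
      by (rule Higman_finite_alphabet[OF assms(1)])
    moreover have "t i \<in> T" "t i < t j"
      using \<open>i < j\<close> T by (simp_all add: t_def enumerate_in_set enumerate_mono)
    ultimately show False
      by (simp add: T_def)
  qed
  then obtain b where b: "\<And>i. i \<ge> b \<Longrightarrow> i \<notin> T"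
    by (metis finite_nat_set_iff_bounded leD)
  have "\<exists>j. j \<ge> b \<and> i < j \<and> subseq (s i) (s j)" if "i \<ge> b" for i
    using b[OF that] that by (auto simp: T_def) (metis less_imp_le le_trans)
  then obtain k where k: "\<And>n. b \<le> k n" "\<And>n. k n < k (Suc n) \<and> subseq (s (k n)) (s (k (Suc n)))"
    using dependent_nat_choice[of "\<lambda>_ i. b \<le> i" "\<lambda>_ i j. i < j \<and> subseq (s i) (s j)"] by blast
  have "subseq (s (k i)) (s (k j))" if "i < j" for i j
    using that by (induction rule: strict_inc_induct)
      (use k(2) subseq_order.order_trans in blast)+
  then show thesis
    using that[of k] k(2) by (simp add: strict_mono_Suc_iff)
qed

text \<open>With \<open>h\<close> strictly monotone on all naturals, not only on the positions of
  \<open>xs\<close>, it is injective outright and \<open>the_inv h\<close> makes sense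
  later.\<close>

lemma subseq_nth_embedding:
  assumes "subseq xs ys"
  obtains h where "strict_mono h" "\<And>i. i < length xs \<Longrightarrow> h i < length ys \<and> ys ! h i = xs ! i"
proof -
  from assms have "\<exists>h. strict_mono h \<and> (\<forall>i<length xs. h i < length ys \<and> ys ! h i = xs ! i)"
  proof (induction rule: list_emb.induct)
    case (list_emb_Nil ys)
    then show ?case by (auto intro: exI[of _ id] strict_monoI)
  next
    case (list_emb_Cons xs ys y)
    then obtain h where "strict_mono h" "\<forall>i<length xs. h i < length ys \<and> ys ! h i = xs ! i"
      by blast
    then show ?case
      by (intro exI[of _ "Suc \<circ> h"]) (auto simp: strict_mono_def)
  next
    case (list_emb_Cons2 x y xs ys)
    then obtain h where "strict_mono h" "\<forall>i<length xs. h i < length ys \<and> ys ! h i = xs ! i"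
      by blast
    then show ?case
      using list_emb_Cons2(1)
      by (intro exI[of _ "case_nat 0 (Suc \<circ> h)"])
         (auto simp: strict_mono_def nth_Cons split: nat.splits)
  qed
  then show thesis
    using that by blast
qed

section \<open>Submodules, spans and left ideals\<close>

lemma (in left_module) smult_l_null: "x \<in> carrier M \<Longrightarrow> \<zero> \<odot>\<^bsub>M\<^esub> x = \<zero>\<^bsub>M\<^esub>"
  by (metis M.add.r_cancel_one R.l_zero R.zero_closed smult_closed smult_l_distr)

lemma (in left_module) smult_r_null: "a \<in> carrier R \<Longrightarrow> a \<odot>\<^bsub>M\<^esub> \<zero>\<^bsub>M\<^esub> = \<zero>\<^bsub>M\<^esub>"
  by (metis M.add.r_cancel_one M.l_zero M.zero_closed smult_closed smult_r_distr)

lemma (in left_module) smult_minus_one: "x \<in> carrier M \<Longrightarrow> (\<ominus> \<one>) \<odot>\<^bsub>M\<^esub> x = \<ominus>\<^bsub>M\<^esub> x"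
  by (metis M.minus_equality R.add.inv_closed R.l_neg R.one_closed smult_closed smult_l_distr
      smult_l_null smult_one)

lemma (in left_module) submodule_iff:
  "submodule H R M \<longleftrightarrow> H \<subseteq> carrier M \<and> \<zero>\<^bsub>M\<^esub> \<in> H \<and>
     (\<forall>x\<in>H. \<forall>y\<in>H. x \<oplus>\<^bsub>M\<^esub> y \<in> H) \<and> (\<forall>a\<in>carrier R. \<forall>x\<in>H. a \<odot>\<^bsub>M\<^esub> x \<in> H)"
    (is "_ \<longleftrightarrow> ?rhs")
proof
  assume "submodule H R M"
  then interpret submodule H R M .
  show ?rhs
    using subset one_closed m_closed smult_closed by auto
next
  assume rhs: ?rhs
  then have "\<ominus>\<^bsub>M\<^esub> x \<in> H" if "x \<in> H" for x
    using that smult_minus_one[of x] by (metis R.a_inv_closed R.one_closed subsetD)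
  then show "submodule H R M"
    using rhs
    by (intro submodule.intro submodule_axioms.intro group.subgroupI[OF M.a_group])
       (auto simp: a_inv_def)
qed

lemma (in left_module) submodule_diff_closed:
  assumes "submodule H R M" "x \<in> H" "y \<in> H"
  shows "x \<ominus>\<^bsub>M\<^esub> y \<in> H"
  using assms smult_minus_one[of y] unfolding submodule_iff a_minus_def
  by (metis R.a_inv_closed R.one_closed subsetD)

lemma (in left_module) submodule_carrier: "submodule (carrier M) R M"
  by (simp add: submodule_iff smult_closed)

lemma left_module_hom_zero:
  assumes "left_module R M" "left_module R N" "h \<in> left_module_hom R M N"
  shows "h \<zero>\<^bsub>M\<^esub> = \<zero>\<^bsub>N\<^esub>"
proof -
  interpret M: left_module R M by fact
  interpret N: left_module R N by fact
  have "h (\<zero>\<^bsub>R\<^esub> \<odot>\<^bsub>M\<^esub> \<zero>\<^bsub>M\<^esub>) = \<zero>\<^bsub>R\<^esub> \<odot>\<^bsub>N\<^esub> h \<zero>\<^bsub>M\<^esub>" and "h \<zero>\<^bsub>M\<^esub> \<in> carrier N"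
    using assms(3) by (auto simp: left_module_hom_def)
  then show ?thesis
    by (simp add: M.smult_l_null N.smult_l_null)
qed

text \<open>The means of pushing spans forward: if \<open>h\<close> maps generators into
  \<open>H\<close>, their span lies in this preimage, so \<open>h\<close> maps the whole span into
  \<open>H\<close>.\<close>

lemma submodule_vimage:
  assumes "left_module R M" "left_module R N" "h \<in> left_module_hom R M N" "submodule H R N"
  shows "submodule {x \<in> carrier M. h x \<in> H} R M"
proof -
  interpret M: left_module R M by fact
  interpret N: left_module R N by fact
  show ?thesis
    using assms(3,4) left_module_hom_zero[OF assms(1-3)]
    unfolding M.submodule_iff N.submodule_iff
    by (auto simp: left_module_hom_def M.smult_closed)
qed

definition submodule_span :: "('k, 'r) ring_scheme \<Rightarrow> ('k, 'm) module \<Rightarrow> 'm set \<Rightarrow> 'm set" where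
  "submodule_span R M G = \<Inter>{H. submodule H R M \<and> G \<subseteq> H}"

lemma submodule_span_superset: "G \<subseteq> submodule_span R M G"
  by (auto simp: submodule_span_def)

lemma submodule_span_mono: "G \<subseteq> H \<Longrightarrow> submodule_span R M G \<subseteq> submodule_span R M H"
  by (auto simp: submodule_span_def)

lemma submodule_span_minimal: "submodule H R M \<Longrightarrow> G \<subseteq> H \<Longrightarrow> submodule_span R M G \<subseteq> H"
  by (auto simp: submodule_span_def)

lemma submodule_span_submodule:
  fixes M :: "('k, 'm) module"
  assumes "left_module R M" "G \<subseteq> carrier M"
  shows "submodule (submodule_span R M G) R M"
proof -
  interpret left_module R M by fact
  have "submodule_span R M G \<subseteq> carrier M"
    using submodule_span_minimal[OF submodule_carrier assms(2)] .
  then show ?thesis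
    unfolding submodule_iff by (auto simp: submodule_span_def submodule_iff)
qed

lemma (in ring) left_ideal_iff:
  "left_ideal I R \<longleftrightarrow> I \<subseteq> carrier R \<and> \<zero> \<in> I \<and>
     (\<forall>x\<in>I. \<forall>y\<in>I. x \<oplus> y \<in> I) \<and> (\<forall>a\<in>carrier R. \<forall>x\<in>I. a \<otimes> x \<in> I)"
    (is "_ \<longleftrightarrow> ?rhs")
proof
  assume "left_ideal I R"
  then interpret left_ideal I R .
  show ?rhs
    using a_subset a_closed I_l_closed by auto
next
  assume rhs: ?rhs
  then have "\<ominus> x \<in> I" if "x \<in> I" for x
    using that l_minus[of \<one> x] by (metis a_inv_closed l_one one_closed subsetD)
  then show "left_ideal I R"
    using rhs
    by (intro left_ideal.intro left_ideal_axioms.intro additive_subgroupI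
        group.subgroupI[OF a_group] ring_axioms)
       (auto simp: a_inv_def)
qed

lemma (in ring) gen_left_ideal_left_ideal:
  assumes "A \<subseteq> carrier R"
  shows "left_ideal (gen_left_ideal R A) R"
proof -
  have "left_ideal (carrier R) R"
    by (simp add: left_ideal_iff)
  then have "gen_left_ideal R A \<subseteq> carrier R"
    using assms by (auto simp: gen_left_ideal_def)
  then show ?thesis
    unfolding left_ideal_iff by (auto simp: gen_left_ideal_def left_ideal_iff)
qed

lemma gen_left_ideal_superset: "A \<subseteq> gen_left_ideal R A"
  by (auto simp: gen_left_ideal_def)

lemma gen_left_ideal_minimal: "left_ideal I R \<Longrightarrow> A \<subseteq> I \<Longrightarrow> gen_left_ideal R A \<subseteq> I"
  by (auto simp: gen_left_ideal_def)

text \<open>The ascending chain condition in the form needed for leading coefficients. The union of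
  the ideals \<open>J m\<close> is a left ideal; its finitely many generators already lie in one
  \<open>J m\<close>, which then contains every \<open>b n\<close>, in particular
  \<open>b m\<close>.\<close>

lemma (in left_noetherian_ring) sequence_in_gen_left_ideal:
  fixes b :: "nat \<Rightarrow> 'a"
  assumes b: "range b \<subseteq> carrier R"
  shows "\<exists>m. b m \<in> gen_left_ideal R (b ` {..<m})"
proof -
  define J where "J m = gen_left_ideal R (b ` {..<m})" for m
  have ideal_J: "left_ideal (J m) R" for m
    unfolding J_def using b by (intro gen_left_ideal_left_ideal) auto
  have mono_J: "J m \<subseteq> J n" if "m \<le> n" for m n
    unfolding J_def using that
    by (intro gen_left_ideal_minimal ideal_J[unfolded J_def])
       (use gen_left_ideal_superset[of "b ` {..<n}" R] in auto)
  have b_J: "b m \<in> J n" if "m < n" for m n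
    using that gen_left_ideal_superset[of "b ` {..<n}" R] by (auto simp: J_def)
  have "left_ideal (\<Union>m. J m) R"
    unfolding left_ideal_iff
  proof (intro conjI ballI)
    fix x y
    assume "x \<in> (\<Union>m. J m)" "y \<in> (\<Union>m. J m)"
    then obtain m n where "x \<in> J m" "y \<in> J n"
      by blast
    then have "x \<in> J (max m n)" "y \<in> J (max m n)"
      using mono_J[of m "max m n"] mono_J[of n "max m n"] by auto
    then show "x \<oplus> y \<in> (\<Union>m. J m)"
      using ideal_J by (auto simp: left_ideal_iff)
  qed (use ideal_J in \<open>unfold left_ideal_iff, blast+\<close>)
  from finitely_gen[OF this] obtain A
    where A: "finite A" "(\<Union>m. J m) = gen_left_ideal R A"
    by auto
  then have "A \<subseteq> (\<Union>m. J m)"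
    using gen_left_ideal_superset[of A R] by simp
  then obtain f where f: "\<And>x. x \<in> A \<Longrightarrow> x \<in> J (f x)"
    by (metis UN_iff subsetD)
  obtain m where "\<And>x. x \<in> A \<Longrightarrow> f x \<le> m"
    using A(1) finite_nat_set_iff_bounded_le[of "f ` A"] by auto
  then have "A \<subseteq> J m"
    using subsetD[OF mono_J f] by auto
  then have "(\<Union>m. J m) \<subseteq> J m"
    using A(2) gen_left_ideal_minimal[OF ideal_J] by simp
  then have "b m \<in> J m"
    using b_J[of m "Suc m"] by blast
  then show ?thesis
    by (auto simp: J_def)
qed

section \<open>Leading terms along an ordered family of vectors\<close>

text \<open>Keeping \<open>J\<close> apart from the index type lets the same \<open>e\<close> and
  \<open>lt\<close> serve the modules at all objects of a representation; \<open>J\<close> then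
  consists of the indices at one object.\<close>

locale leading_terms = left_module R M
  for R :: "('k, 'r) ring_scheme" (structure) and M :: "('k, 'm) module" (structure) +
  fixes J :: "'i set" and e :: "'i \<Rightarrow> 'm" and lt :: "('i \<times> 'i) set"
  assumes e_closed: "i \<in> J \<Longrightarrow> e i \<in> carrier M"
    and trans_lt: "trans lt"
    and total_lt: "total_on J lt"
begin

text \<open>The elements \<open>e i\<close> need not be linearly independent, so an element may lead at several
  indices.\<close>

definition lower :: "'i \<Rightarrow> 'm set" where
  "lower i = submodule_span R M (e ` {j \<in> J. (j, i) \<in> lt})"

text \<open>The coefficient may be zero. Thus the coefficients occurring at \<open>i\<close> form a
  left ideal, and a sum of two vectors leading at \<open>i\<close> leads at \<open>i\<close> even if
  their coefficients cancel.\<close>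

definition leads :: "'m \<Rightarrow> 'i \<Rightarrow> 'k \<Rightarrow> bool" where
  "leads x i a \<longleftrightarrow> i \<in> J \<and> a \<in> carrier R \<and> (\<exists>y\<in>lower i. x = a \<odot>\<^bsub>M\<^esub> e i \<oplus>\<^bsub>M\<^esub> y)"

lemma lower_submodule: "submodule (lower i) R M"
  unfolding lower_def
  by (rule submodule_span_submodule) (use left_module_axioms e_closed in auto)

lemma lower_closed: "y \<in> lower i \<Longrightarrow> y \<in> carrier M"
  using lower_submodule[of i] by (auto simp: submodule_iff)

lemma leads_closed: "leads x i a \<Longrightarrow> x \<in> carrier M"
  using lower_closed by (auto simp: leads_def e_closed smult_closed)

lemma leads_imp_lower:
  assumes "leads x j a" "(j, i) \<in> lt"
  shows "x \<in> lower i"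
proof -
  have e_lower: "e k \<in> lower i" if "k \<in> J" "(k, i) \<in> lt" for k
    using submodule_span_superset[of "e ` {k \<in> J. (k, i) \<in> lt}" R M] that
    unfolding lower_def by blast
  then have "lower j \<subseteq> lower i"
    using submodule_span_minimal[OF lower_submodule, of "e ` {k \<in> J. (k, j) \<in> lt}" i]
      transD[OF trans_lt _ assms(2)]
    unfolding lower_def[of j] by blast
  moreover have "j \<in> J \<Longrightarrow> e j \<in> lower i"
    using e_lower assms(2) by blast
  ultimately show ?thesis
    using assms(1) lower_submodule[of i] unfolding leads_def submodule_iff by blast
qed

lemma leads_add:
  assumes "leads x i a" "leads y i b"
  shows "leads (x \<oplus>\<^bsub>M\<^esub> y) i (a \<oplus> b)"
proof -
  from assms obtain x' y' where "x' \<in> lower i" "x = a \<odot>\<^bsub>M\<^esub> e i \<oplus>\<^bsub>M\<^esub> x'"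
      "y' \<in> lower i" "y = b \<odot>\<^bsub>M\<^esub> e i \<oplus>\<^bsub>M\<^esub> y'" "a \<in> carrier R" "b \<in> carrier R" "i \<in> J"
    by (auto simp: leads_def)
  then have "x' \<oplus>\<^bsub>M\<^esub> y' \<in> lower i" "x \<oplus>\<^bsub>M\<^esub> y = (a \<oplus> b) \<odot>\<^bsub>M\<^esub> e i \<oplus>\<^bsub>M\<^esub> (x' \<oplus>\<^bsub>M\<^esub> y')"
    using lower_submodule[of i] lower_closed[of _ i]
    by (simp_all add: submodule_iff smult_l_distr e_closed smult_closed M.add.m_ac)
  then show ?thesis
    using assms by (auto simp: leads_def)
qed

lemma leads_add_lower:
  assumes "leads x i a" "y \<in> lower i"
  shows "leads (x \<oplus>\<^bsub>M\<^esub> y) i a"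
proof -
  from assms(1) obtain x' where "x' \<in> lower i" "x = a \<odot>\<^bsub>M\<^esub> e i \<oplus>\<^bsub>M\<^esub> x'" "a \<in> carrier R" "i \<in> J"
    by (auto simp: leads_def)
  then have "x' \<oplus>\<^bsub>M\<^esub> y \<in> lower i" "x \<oplus>\<^bsub>M\<^esub> y = a \<odot>\<^bsub>M\<^esub> e i \<oplus>\<^bsub>M\<^esub> (x' \<oplus>\<^bsub>M\<^esub> y)"
    using lower_submodule[of i] lower_closed[of _ i] assms(2)
    by (simp_all add: submodule_iff e_closed smult_closed M.add.m_ac)
  then show ?thesis
    using assms by (auto simp: leads_def)
qed

lemma leads_smult:
  assumes "leads x i a" "c \<in> carrier R"
  shows "leads (c \<odot>\<^bsub>M\<^esub> x) i (c \<otimes> a)"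
proof -
  from assms(1) obtain x' where "x' \<in> lower i" "x = a \<odot>\<^bsub>M\<^esub> e i \<oplus>\<^bsub>M\<^esub> x'" "a \<in> carrier R" "i \<in> J"
    by (auto simp: leads_def)
  then have "c \<odot>\<^bsub>M\<^esub> x' \<in> lower i" "c \<odot>\<^bsub>M\<^esub> x = (c \<otimes> a) \<odot>\<^bsub>M\<^esub> e i \<oplus>\<^bsub>M\<^esub> c \<odot>\<^bsub>M\<^esub> x'"
    using lower_submodule[of i] lower_closed[of _ i] assms(2)
    by (simp_all add: submodule_iff e_closed smult_closed smult_r_distr smult_assoc1)
  then show ?thesis
    using assms by (auto simp: leads_def)
qed

lemma leads_zero: "i \<in> J \<Longrightarrow> leads \<zero>\<^bsub>M\<^esub> i \<zero>"
  using lower_submodule[of i]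
  by (auto simp: leads_def submodule_iff smult_l_null e_closed intro!: bexI[of _ "\<zero>\<^bsub>M\<^esub>"])

lemma leads_e: "i \<in> J \<Longrightarrow> leads (e i) i \<one>"
  using lower_submodule[of i]
  by (auto simp: leads_def submodule_iff smult_one e_closed intro!: bexI[of _ "\<zero>\<^bsub>M\<^esub>"])

lemma leads_diff:
  assumes "leads x i a" "leads y i a"
  shows "x \<ominus>\<^bsub>M\<^esub> y \<in> lower i"
proof -
  from assms obtain x' y' where xy: "x' \<in> lower i" "x = a \<odot>\<^bsub>M\<^esub> e i \<oplus>\<^bsub>M\<^esub> x'"
      "y' \<in> lower i" "y = a \<odot>\<^bsub>M\<^esub> e i \<oplus>\<^bsub>M\<^esub> y'" "a \<in> carrier R" "i \<in> J"
    by (auto simp: leads_def)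
  then have car: "x' \<in> carrier M" "y' \<in> carrier M" "a \<odot>\<^bsub>M\<^esub> e i \<in> carrier M"
    using lower_closed by (auto simp: e_closed smult_closed)
  have "x \<ominus>\<^bsub>M\<^esub> y = x' \<ominus>\<^bsub>M\<^esub> y'"
    unfolding xy(2,4) a_minus_def using car
    by (simp add: M.minus_add M.a_ac M.r_neg2 M.r_neg)
  then show ?thesis
    using submodule_diff_closed[OF lower_submodule xy(1,3)] by simp
qed

lemma left_ideal_leads:
  assumes "submodule H R M" "i \<in> J"
  shows "left_ideal {a. \<exists>x\<in>H. leads x i a} R"
proof -
  have "a \<in> carrier R" if "leads x i a" for x a
    using that by (simp add: leads_def)
  then show ?thesis
    using assms leads_zero[of i] leads_add[of _ i] leads_smult[of _ i]
    unfolding R.left_ideal_iff submodule_iff by blast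
qed

text \<open>Zero together with the vectors leading at some index of \<open>D\<close> is a submodule:
  by totality a sum of two such vectors leads at the larger index. It contains each
  \<open>e i\<close> for \<open>i\<close> in \<open>D\<close>, hence the span. Zero is inserted
  separately because \<open>D\<close> may be empty. Taking for \<open>D\<close> the indices below
  \<open>i\<close> yields a leading index strictly below \<open>i\<close>.\<close>

lemma span_imp_leads:
  assumes "D \<subseteq> J" "x \<in> submodule_span R M (e ` D)" "x \<noteq> \<zero>\<^bsub>M\<^esub>"
  obtains i a where "i \<in> D" "leads x i a"
proof -
  define H where "H = insert \<zero>\<^bsub>M\<^esub> {x. \<exists>i\<in>D. \<exists>a. leads x i a}"
  have H_closed: "H \<subseteq> carrier M"
    using leads_closed by (auto simp: H_def)
  have add: "\<exists>k\<in>D. \<exists>c. leads (x \<oplus>\<^bsub>M\<^esub> y) k c"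
    if "leads x i a" "leads y j b" "i \<in> D" "j \<in> D" for x y i j a b
  proof -
    have "i \<in> J" "j \<in> J"
      using that assms(1) by auto
    then consider "i = j" | "(i, j) \<in> lt" | "(j, i) \<in> lt"
      using total_lt unfolding total_on_def by blast
    then show ?thesis
    proof cases
      case 1
      then show ?thesis using that leads_add by blast
    next
      case 2
      then have "leads (y \<oplus>\<^bsub>M\<^esub> x) j b"
        using that leads_add_lower leads_imp_lower by blast
      then show ?thesis
        using that M.a_comm leads_closed by metis
    next
      case 3
      then show ?thesis
        using that leads_add_lower leads_imp_lower by blast
    qed
  qed
  have "submodule H R M"
    unfolding submodule_iff
  proof (intro conjI ballI)
    fix x y
    assume xy: "x \<in> H" "y \<in> H"
    show "x \<oplus>\<^bsub>M\<^esub> y \<in> H"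
    proof (cases "x = \<zero>\<^bsub>M\<^esub> \<or> y = \<zero>\<^bsub>M\<^esub>")
      case True
      then show ?thesis using xy H_closed by auto
    next
      case False
      then obtain i a j b where "leads x i a" "leads y j b" "i \<in> D" "j \<in> D"
        using xy by (auto simp: H_def)
      from add[OF this] show ?thesis
        by (auto simp: H_def)
    qed
  next
    fix a x
    assume "a \<in> carrier R" "x \<in> H"
    then show "a \<odot>\<^bsub>M\<^esub> x \<in> H"
      using leads_smult smult_r_null unfolding H_def by blast
  qed (use H_closed in \<open>auto simp: H_def\<close>)
  moreover have "e ` D \<subseteq> H"
    using leads_e assms(1) by (auto simp: H_def)
  ultimately have "x \<in> H"
    using submodule_span_minimal assms(2) by blast
  then show thesis
    using that assms(3) by (auto simp: H_def)
qed

end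

text \<open>By the last assumption \<open>h\<close> sends the generators of \<open>lower i\<close>
  to generators of the corresponding submodule at \<open>j\<close>, so all lower terms stay lower
  while the coefficient is kept.\<close>

lemma leads_hom:
  assumes "leading_terms R M J e lt" "leading_terms R M' J' e lt" "h \<in> left_module_hom R M M'"
    and "leading_terms.leads R M J e lt x i a" "h (e i) = e j" "j \<in> J'"
    and "\<And>i'. i' \<in> J \<Longrightarrow> (i', i) \<in> lt \<Longrightarrow> \<exists>j'\<in>J'. (j', j) \<in> lt \<and> h (e i') = e j'"
  shows "leading_terms.leads R M' J' e lt (h x) j a"
proof -
  interpret M: leading_terms R M J e lt by fact
  interpret M': leading_terms R M' J' e lt by fact
  from assms(4) obtain y where y: "i \<in> J" "a \<in> carrier R" "y \<in> M.lower i"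
    "x = a \<odot>\<^bsub>M\<^esub> e i \<oplus>\<^bsub>M\<^esub> y"
    by (auto simp: M.leads_def)
  have "e ` {k \<in> J. (k, i) \<in> lt} \<subseteq> {x \<in> carrier M. h x \<in> M'.lower j}"
  proof (rule image_subsetI)
    fix k
    assume k: "k \<in> {k \<in> J. (k, i) \<in> lt}"
    then obtain j' where "j' \<in> {k \<in> J'. (k, j) \<in> lt}" "h (e k) = e j'"
      using assms(7) by blast
    then have "h (e k) \<in> M'.lower j"
      using submodule_span_superset unfolding M'.lower_def by fastforce
    then show "e k \<in> {x \<in> carrier M. h x \<in> M'.lower j}"
      using k M.e_closed by simp
  qed
  then have "M.lower i \<subseteq> {x \<in> carrier M. h x \<in> M'.lower j}"
    unfolding M.lower_def
    by (intro submodule_span_minimal submodule_vimage[OF _ _ assms(3) M'.lower_submodule]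
        M.left_module_axioms M'.left_module_axioms)
  moreover have "h x = a \<odot>\<^bsub>M'\<^esub> e j \<oplus>\<^bsub>M'\<^esub> h y"
    using assms(3,5) y M.lower_closed M.e_closed M.smult_closed
    by (auto simp: left_module_hom_def)
  ultimately show ?thesis
    using y assms(6) by (auto simp: M'.leads_def)
qed

section \<open>Generated subrepresentations and the Groebner criterion\<close>

definition generated_subrep ::
    "('k, 'r) ring_scheme \<Rightarrow> ('o, 'f) category \<Rightarrow> ('o, 'f, 'k, 'm) rep \<Rightarrow> ('o \<times> 'm) set
      \<Rightarrow> 'o \<Rightarrow> 'm set" where
  "generated_subrep R C M A x = (\<Inter>N\<in>{N. subrep R C M N \<and> (\<forall>(y, v)\<in>A. v \<in> N y)}. N x)"

lemma generated_subrep_minimal: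
  assumes "subrep R C M N" "\<And>y v. (y, v) \<in> A \<Longrightarrow> v \<in> N y"
  shows "generated_subrep R C M A x \<subseteq> N x"
  using assms by (auto simp: generated_subrep_def)

lemma generated_subrep_superset: "(x, v) \<in> A \<Longrightarrow> v \<in> generated_subrep R C M A x"
  by (auto simp: generated_subrep_def)

context representation
begin

lemma submodule_ObjMap_iff:
  assumes "x \<in> Obj C"
  shows "submodule H R (ObjMap M x) \<longleftrightarrow> H \<subseteq> carrier (ObjMap M x) \<and> \<zero>\<^bsub>ObjMap M x\<^esub> \<in> H \<and>
     (\<forall>v\<in>H. \<forall>w\<in>H. v \<oplus>\<^bsub>ObjMap M x\<^esub> w \<in> H) \<and>
     (\<forall>a\<in>carrier R. \<forall>v\<in>H. a \<odot>\<^bsub>ObjMap M x\<^esub> v \<in> H)"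
  using left_module.submodule_iff[OF ObjMap_module[OF assms]] .

lemma subrep_submodule: "subrep R C M N \<Longrightarrow> x \<in> Obj C \<Longrightarrow> submodule (N x) R (ObjMap M x)"
  by (simp add: subrep_def)

lemma subrep_subset: "subrep R C M N \<Longrightarrow> x \<in> Obj C \<Longrightarrow> N x \<subseteq> carrier (ObjMap M x)"
  using subrep_submodule[of N x] submodule_ObjMap_iff[of x "N x"] by simp

lemma subrep_ArrMap:
  "\<lbrakk>subrep R C M N; x \<in> Obj C; y \<in> Obj C; f \<in> Hom C x y; v \<in> N x\<rbrakk> \<Longrightarrow> ArrMap M x y f v \<in> N y"
  unfolding subrep_def by blast

lemma subrep_carrier: "subrep R C M (\<lambda>x. carrier (ObjMap M x))"
  using left_module.submodule_carrier[OF ObjMap_module] ArrMap_hom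
  by (fastforce simp: subrep_def left_module_hom_def)

lemma subrep_generated_subrep:
  assumes "A \<subseteq> rep_elements C M"
  shows "subrep R C M (generated_subrep R C M A)"
proof -
  have "\<And>y v. (y, v) \<in> A \<Longrightarrow> v \<in> carrier (ObjMap M y)"
    using assms by (auto simp: rep_elements_def)
  then have car: "generated_subrep R C M A x \<subseteq> carrier (ObjMap M x)" for x
    by (rule generated_subrep_minimal[OF subrep_carrier])
  show ?thesis
    unfolding subrep_def
  proof (intro conjI ballI)
    fix x
    assume x: "x \<in> Obj C"
    have *: "\<zero>\<^bsub>ObjMap M x\<^esub> \<in> N x"
        "v \<in> N x \<Longrightarrow> w \<in> N x \<Longrightarrow> v \<oplus>\<^bsub>ObjMap M x\<^esub> w \<in> N x"
        "a \<in> carrier R \<Longrightarrow> v \<in> N x \<Longrightarrow> a \<odot>\<^bsub>ObjMap M x\<^esub> v \<in> N x"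
      if "subrep R C M N" for N v w a
      using subrep_submodule[OF that x] by (auto simp: submodule_ObjMap_iff[OF x])
    show "submodule (generated_subrep R C M A x) R (ObjMap M x)"
      unfolding submodule_ObjMap_iff[OF x]
      using car[of x] by (simp add: generated_subrep_def *)
  next
    fix x y f
    assume xyf: "x \<in> Obj C" "y \<in> Obj C" "f \<in> Hom C x y"
    have "ArrMap M x y f v \<in> N y"
      if "v \<in> generated_subrep R C M A x" "subrep R C M N" "\<forall>(y, v)\<in>A. v \<in> N y" for v N
    proof -
      have "v \<in> N x"
        using that by (auto simp: generated_subrep_def)
      then show ?thesis
        using subrep_ArrMap that(2) xyf by simp
    qed
    then show "ArrMap M x y f ` generated_subrep R C M A x \<subseteq> generated_subrep R C M A y"
      by (subst (2) generated_subrep_def) auto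
  qed
qed

text \<open>A subrepresentation of the restriction to \<open>N\<close> is also one of
  \<open>M\<close>, so generation of \<open>N\<close> can be tested inside \<open>M\<close>.\<close>

lemma finitely_generated_restrict_rep:
  assumes N: "subrep R C M N"
    and A: "finite A" "\<And>x v. (x, v) \<in> A \<Longrightarrow> x \<in> Obj C \<and> v \<in> N x"
    and gen: "\<And>x. x \<in> Obj C \<Longrightarrow> N x \<subseteq> generated_subrep R C M A x"
  shows "finitely_generated_rep R C (restrict_rep M N)"
proof -
  interpret restr: representation R C "restrict_rep M N"
    by (rule representation_restrict_rep[OF N])
  have obj: "ObjMap (restrict_rep M N) = (\<lambda>x. (ObjMap M x)\<lparr>carrier := N x\<rparr>)"
    and arr: "ArrMap (restrict_rep M N) = ArrMap M"
    by (simp_all add: restrict_rep_def)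
  note sub_N = subrep_subset[OF N]
  have "subrep R C M N'" if N': "subrep R C (restrict_rep M N) N'" for N'
    unfolding subrep_def
  proof (intro conjI ballI)
    fix x
    assume x: "x \<in> Obj C"
    then have "submodule (N' x) R (ObjMap (restrict_rep M N) x)"
      by (rule restr.subrep_submodule[OF N'])
    then show "submodule (N' x) R (ObjMap M x)"
      using sub_N[OF x] unfolding submodule_ObjMap_iff[OF x] restr.submodule_ObjMap_iff[OF x]
      by (simp add: obj) (meson subset_trans)
  next
    fix x y f
    assume "x \<in> Obj C" "y \<in> Obj C" "f \<in> Hom C x y"
    then show "ArrMap M x y f ` N' x \<subseteq> N' y"
      using N' by (simp add: subrep_def arr)
  qed
  then have "N x \<subseteq> N' x"
    if "subrep R C (restrict_rep M N) N'" "\<forall>(x, v)\<in>A. v \<in> N' x" "x \<in> Obj C" for N' x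
    using gen[OF that(3)] generated_subrep_minimal[of R C M N' A x] that by blast
  moreover have "A \<subseteq> rep_elements C (restrict_rep M N)"
    using A(2) by (auto simp: rep_elements_def obj)
  moreover have "v \<in> carrier (ObjMap (restrict_rep M N) x)" if "(x, v) \<in> A" for x v
    using A(2)[OF that] by (simp add: obj)
  ultimately show ?thesis
    using A(1) restr.subrep_carrier
    unfolding finitely_generated_rep_def smallest_subrep_def
    by (intro exI[of _ A]) (auto simp: obj)
qed

text \<open>If \<open>N\<close> is not finitely generated, choose successively \<open>v\<^sub>n \<in> N\<close> outside the part
  generated by the previous choices, with minimal leading index. Along a \<open>le\<close>-chain some leading
  coefficient lies in the left ideal generated by the earlier ones; subtracting the
  corresponding combination of images of earlier elements lowers the leading index.\<close>

theorem finitely_generated_restrict_rep_if_Groebner: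
  fixes I :: "'i set" and ob :: "'i \<Rightarrow> 'o" and e :: "'i \<Rightarrow> 'm" and lt :: "('i \<times> 'i) set"
    and le :: "'i \<Rightarrow> 'i \<Rightarrow> bool" and D :: "'o set"
  assumes noeth: "left_noetherian_ring R"
    and N: "subrep R C M N"
    and I: "\<And>i. i \<in> I \<Longrightarrow> ob i \<in> Obj C \<and> e i \<in> carrier (ObjMap M (ob i))"
    and wf: "wf lt"
    and trans: "trans lt"
    and total: "\<And>x. total_on {i \<in> I. ob i = x} lt"
    and le: "\<And>i j. i \<in> I \<Longrightarrow> j \<in> I \<Longrightarrow> le i j \<Longrightarrow>
      \<exists>f\<in>Hom C (ob i) (ob j). ArrMap M (ob i) (ob j) f (e i) = e j \<and>
        (\<forall>i'\<in>I. ob i' = ob i \<and> (i', i) \<in> lt \<longrightarrow>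
          (\<exists>j'\<in>I. ob j' = ob j \<and> (j', j) \<in> lt \<and> ArrMap M (ob i) (ob j) f (e i') = e j'))"
    and wqo: "\<And>s :: nat \<Rightarrow> 'i. range s \<subseteq> I \<Longrightarrow>
      \<exists>k :: nat \<Rightarrow> nat. strict_mono k \<and> (\<forall>l m. l < m \<longrightarrow> le (s (k l)) (s (k m)))"
    and D: "D \<subseteq> Obj C"
    and span: "\<And>x. x \<in> D \<Longrightarrow>
      carrier (ObjMap M x) \<subseteq> submodule_span R (ObjMap M x) (e ` {i \<in> I. ob i = x})"
    and retract: "\<And>y. y \<in> Obj C \<Longrightarrow>
      \<exists>x\<in>D. \<exists>f\<in>Hom C y x. \<exists>g\<in>Hom C x y. Comp C y x y g f = Ident C y"
  shows "finitely_generated_rep R C (restrict_rep M N)"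
proof (rule ccontr)
  assume not_fg: "\<not> finitely_generated_rep R C (restrict_rep M N)"
  interpret noeth: left_noetherian_ring R by fact
  define J where "J x = {i \<in> I. ob i = x}" for x
  define leads where "leads x = leading_terms.leads R (ObjMap M x) (J x) e lt" for x
  define gen where "gen = generated_subrep R C M"
  have LT: "leading_terms R (ObjMap M x) (J x) e lt" if "x \<in> Obj C" for x
  proof (intro leading_terms.intro leading_terms_axioms.intro ObjMap_module that trans)
    show "e i \<in> carrier (ObjMap M x)" if "i \<in> J x" for i
      using I that by (auto simp: J_def)
    show "total_on (J x) lt"
      unfolding J_def by (rule total)
  qed
  note N_mod = subrep_submodule[OF N]
  define adm where "adm A \<longleftrightarrow> finite A \<and> (\<forall>(x, v)\<in>A. x \<in> Obj C \<and> v \<in> N x)" for A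
  have gen_sub: "subrep R C M (gen A)" and gen_N: "gen A x \<subseteq> N x" if "adm A" for A x
  proof -
    have "v \<in> N y \<and> y \<in> Obj C" if "(y, v) \<in> A" for y v
      using \<open>adm A\<close> that by (auto simp: adm_def)
    moreover from this have "A \<subseteq> rep_elements C M"
      using subrep_subset[OF N] by (fastforce simp: rep_elements_def)
    ultimately show "subrep R C M (gen A)" "gen A x \<subseteq> N x"
      unfolding gen_def by (simp_all add: subrep_generated_subrep generated_subrep_minimal[OF N])
  qed
  note gen_mod = subrep_submodule[OF gen_sub]
  define cand where
    "cand A = (\<lambda>(v, i, a). i \<in> I \<and> v \<in> N (ob i) \<and> v \<notin> gen A (ob i) \<and> leads (ob i) v i a)" for A
  have cand_ex: "\<exists>t. cand A t" if A: "adm A" for A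
  proof -
    obtain y v where y: "y \<in> Obj C" and v: "v \<in> N y" "v \<notin> gen A y"
      using not_fg finitely_generated_restrict_rep[OF N, of A] A
      unfolding adm_def gen_def by blast
    \<comment> \<open>The vectors \<open>e i\<close> are known to span only at objects of
      \<open>D\<close>, so \<open>v\<close> is moved to such an object. As \<open>g\<close> brings
      it back, its image still lies outside the part generated by \<open>A\<close>.\<close>
    obtain x f g where x: "x \<in> D" and f: "f \<in> Hom C y x" and g: "g \<in> Hom C x y"
      and gf: "Comp C y x y g f = Ident C y"
      using retract[OF y] by blast
    then have xC: "x \<in> Obj C"
      using D by blast
    define w where "w = ArrMap M y x f v"
    have "w \<in> N x"
      using subrep_ArrMap[OF N y xC f v(1)] by (simp add: w_def)
    have v_car: "v \<in> carrier (ObjMap M y)"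
      using subrep_subset[OF N y] v(1) by blast
    have "ArrMap M x y g w = v"
      using ArrMap_Comp[OF y xC y f g v_car] ArrMap_Ident[OF y v_car] by (simp add: gf w_def)
    then have "w \<notin> gen A x"
      using subrep_ArrMap[OF gen_sub[OF A] xC y g] v(2) by auto
    then have "w \<noteq> \<zero>\<^bsub>ObjMap M x\<^esub>"
      using gen_mod[OF A xC] unfolding submodule_ObjMap_iff[OF xC] by blast
    moreover have "w \<in> submodule_span R (ObjMap M x) (e ` J x)"
      using subrep_subset[OF N xC] \<open>w \<in> N x\<close> span[OF x] unfolding J_def by blast
    ultimately obtain i a where "i \<in> J x" "leads x w i a"
      using leading_terms.span_imp_leads[OF LT[OF xC] subset_refl] unfolding leads_def by metis
    then have "cand A (w, i, a)"
      using \<open>w \<in> N x\<close> \<open>w \<notin> gen A x\<close> by (auto simp: cand_def J_def)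
    then show ?thesis ..
  qed
  \<comment> \<open>Only the index of the triple is minimised, and this over the candidates at all
    objects; vector and coefficient are then arbitrary.\<close>
  define t where
    "t A = (SOME t. cand A t \<and> (\<forall>t'. cand A t' \<longrightarrow> (fst (snd t'), fst (snd t)) \<notin> lt))" for A
  have "\<exists>t. cand A t \<and> (\<forall>t'. cand A t' \<longrightarrow> (fst (snd t'), fst (snd t)) \<notin> lt)" if A: "adm A" for A
  proof -
    obtain t0 where t0: "t0 \<in> Collect (cand A)"
      using cand_ex[OF A] by auto
    obtain t1 where "t1 \<in> Collect (cand A)"
        "\<And>t'. (t', t1) \<in> inv_image lt (\<lambda>t. fst (snd t)) \<Longrightarrow> t' \<notin> Collect (cand A)"
      using wfE_min[OF wf_inv_image[OF wf, of "\<lambda>t. fst (snd t)"] t0] by metis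
    then show ?thesis
      unfolding in_inv_image mem_Collect_eq by (intro exI[of _ t1] conjI allI impI notI) blast+
  qed
  from someI_ex[OF this] have "cand A (t A) \<and> (\<forall>t'. cand A t' \<longrightarrow> (fst (snd t'), fst (snd (t A))) \<notin> lt)"
    if "adm A" for A
    unfolding t_def using that by blast
  then have t: "adm A \<Longrightarrow> cand A (t A)"
    and t_min: "adm A \<Longrightarrow> cand A t' \<Longrightarrow> (fst (snd t'), fst (snd (t A))) \<notin> lt" for A t'
    by blast+
  define v where "v A = fst (t A)" for A
  define i where "i A = fst (snd (t A))" for A
  define a where "a A = snd (snd (t A))" for A
  have cand_t: "i A \<in> I" "v A \<in> N (ob (i A))" "v A \<notin> gen A (ob (i A))"
      "leads (ob (i A)) (v A) (i A) (a A)" if "adm A" for A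
    using t[OF that] by (simp_all add: cand_def v_def i_def a_def split_beta)
  define B where "B = rec_nat {} (\<lambda>_ A. insert (ob (i A), v A) A)"
  have B_Suc: "B (Suc n) = insert (ob (i (B n)), v (B n)) (B n)" and B_0: "B 0 = {}" for n
    by (simp_all add: B_def)
  have adm_B: "adm (B n)" for n
  proof (induction n)
    case 0
    show ?case by (simp add: B_0 adm_def)
  next
    case (Suc n)
    then show ?case
      using cand_t[OF Suc] I by (simp add: B_Suc adm_def)
  qed
  have mem_B: "(ob (i (B m)), v (B m)) \<in> B n" if "m < n" for m n
    using that by (induction n) (auto simp: B_Suc less_Suc_eq)
  note cand_B = cand_t[OF adm_B]
  have "range (\<lambda>n. i (B n)) \<subseteq> I"
    using cand_B(1) by auto
  then obtain k :: "nat \<Rightarrow> nat"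
    where k: "strict_mono k" "\<And>l m. l < m \<Longrightarrow> le (i (B (k l))) (i (B (k m)))"
    using wqo by blast
  define b where "b n = a (B (k n))" for n
  have "b n \<in> carrier R" for n
    using cand_B(4)[of "k n"] I[OF cand_B(1)] leading_terms.leads_def[OF LT]
    by (simp add: b_def leads_def)
  then obtain m where m: "b m \<in> gen_left_ideal R (b ` {..<m})"
    using noeth.sequence_in_gen_left_ideal[of b] by auto
  \<comment> \<open>\<open>A\<close> collects the choices made before the one numbered
    \<open>k m\<close>. Since \<open>k\<close> is strictly monotone it contains those numbered
    \<open>k l\<close> for \<open>l < m\<close>, whose coefficients generate a left ideal containing
    that of the new choice.\<close>
  define A where "A = B (k m)"
  define x where "x = ob (i A)"
  have A: "adm A" and iA: "i A \<in> I" and x: "x \<in> Obj C" and iJ: "i A \<in> J x"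
    using adm_B cand_B(1) I by (auto simp: A_def x_def J_def)
  have b_m: "b m = a A"
    by (simp add: b_def A_def)
  interpret LT: leading_terms R "ObjMap M x" "J x" e lt
    by (rule LT[OF x])
  have leads_x: "leads x = LT.leads"
    by (simp add: leads_def)
  have "b l \<in> {c. \<exists>z\<in>gen A x. LT.leads z (i A) c}" if "l < m" for l
  proof -
    let ?l = "B (k l)"
    let ?y = "ob (i ?l)"
    have y: "?y \<in> Obj C"
      using I cand_B(1) by blast
    have "le (i ?l) (i A)"
      using k(2)[OF that] by (simp add: A_def)
    from le[OF cand_B(1) iA this] obtain f where f: "f \<in> Hom C ?y x"
      and fe: "ArrMap M ?y x f (e (i ?l)) = e (i A)"
      and f_lt: "\<And>i'. i' \<in> I \<Longrightarrow> ob i' = ?y \<Longrightarrow> (i', i ?l) \<in> lt \<Longrightarrow>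
        \<exists>j'\<in>I. ob j' = x \<and> (j', i A) \<in> lt \<and> ArrMap M ?y x f (e i') = e j'"
      unfolding x_def by blast
    have "v ?l \<in> gen A ?y"
      using mem_B[of "k l" "k m"] k(1) that
      by (auto simp: gen_def A_def strict_mono_less intro: generated_subrep_superset)
    then have "ArrMap M ?y x f (v ?l) \<in> gen A x"
      by (rule subrep_ArrMap[OF gen_sub[OF A] y x f])
    moreover have "LT.leads (ArrMap M ?y x f (v ?l)) (i A) (b l)"
      using cand_B(4)[of "k l"] f_lt
      by (intro leads_hom[OF LT[OF y] LT[OF x] ArrMap_hom[OF y x f] _ fe iJ])
         (auto simp: leads_def b_def J_def)
    ultimately show ?thesis by blast
  qed
  then have "b ` {..<m} \<subseteq> {c. \<exists>z\<in>gen A x. LT.leads z (i A) c}"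
    by blast
  then have "b m \<in> {c. \<exists>z\<in>gen A x. LT.leads z (i A) c}"
    using m gen_left_ideal_minimal[OF LT.left_ideal_leads[OF gen_mod[OF A x] iJ]] by blast
  then obtain z where z: "z \<in> gen A x" "LT.leads z (i A) (a A)"
    by (auto simp: b_m)
  have v: "v A \<in> N x" "v A \<notin> gen A x" "LT.leads (v A) (i A) (a A)"
    using cand_t[OF A] by (simp_all add: x_def leads_x[unfolded x_def])
  define w where "w = v A \<ominus>\<^bsub>ObjMap M x\<^esub> z"
  have "z \<in> carrier (ObjMap M x)" "v A \<in> carrier (ObjMap M x)"
    using z(2) v(3) LT.leads_closed by auto
  then have "v A = w \<oplus>\<^bsub>ObjMap M x\<^esub> z"
    by (simp add: w_def a_minus_def LT.M.a_assoc LT.M.l_neg)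
  then have "w \<notin> gen A x"
    using v(2) z(1) gen_mod[OF A x] unfolding submodule_ObjMap_iff[OF x] by metis
  moreover have "w \<in> N x"
    unfolding w_def using LT.submodule_diff_closed[OF N_mod[OF x] v(1)] gen_N[OF A] z(1) by blast
  moreover have "w \<in> submodule_span R (ObjMap M x) (e ` {j \<in> J x. (j, i A) \<in> lt})"
    using LT.leads_diff[OF v(3) z(2)] by (simp add: w_def LT.lower_def)
  moreover have "w \<noteq> \<zero>\<^bsub>ObjMap M x\<^esub>"
    using \<open>w \<notin> gen A x\<close> gen_mod[OF A x] unfolding submodule_ObjMap_iff[OF x] by blast
  ultimately obtain j c where "j \<in> J x" "(j, i A) \<in> lt" "LT.leads w j c"
    using LT.span_imp_leads[of "{j \<in> J x. (j, i A) \<in> lt}" w] by blast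
  then have "cand A (w, j, c)"
    using \<open>w \<in> N x\<close> \<open>w \<notin> gen A x\<close> by (auto simp: cand_def J_def leads_x)
  then show False
    using t_min[OF A] \<open>(j, i A) \<in> lt\<close> by (force simp: i_def)
qed

end

section \<open>Strict well-orders and the lexicographic order\<close>

text \<open>Serves to order letters and generators, which carry no order of their own.\<close>

lemma ex_wf_trans_total: "\<exists>r :: ('a \<times> 'a) set. wf r \<and> trans r \<and> total r"
proof -
  obtain r :: "('a \<times> 'a) set" where r: "well_order_on UNIV r"
    using well_order_on by blast
  then have "trans r" "antisym r" "total r" "wf (r - Id)"
    by (auto simp: well_order_on_def linear_order_on_def partial_order_on_def preorder_on_def)
  moreover from this have "trans (r - Id)"
    by (simp add: trans_diff_Id)
  ultimately show ?thesis
    by (intro exI[of _ "r - Id"]) (auto simp: total_on_def)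
qed

lemma lex_iff_nth:
  assumes "length xs = length ys"
  shows "(xs, ys) \<in> lex r \<longleftrightarrow> (\<exists>i<length ys. (\<forall>j<i. xs ! j = ys ! j) \<and> (xs ! i, ys ! i) \<in> r)"
proof -
  have "take i xs = take i ys \<longleftrightarrow> (\<forall>j<i. xs ! j = ys ! j)" if "i < length ys" for i
    using assms that by (auto simp: list_eq_iff_nth_eq)
  then show ?thesis
    using assms by (auto simp: lexord_lex lexord_take_index_conv)
qed

lemma lex_linear:
  assumes "total r" "length xs = length ys" "xs \<noteq> ys"
  shows "(xs, ys) \<in> lex r \<or> (ys, xs) \<in> lex r"
  using assms total_lexord[OF assms(1)] by (auto simp: lexord_lex total_on_def)

section \<open>Words of morphisms into initial segments\<close>

context
  fixes enum :: "nat \<Rightarrow> 'x"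
  assumes inj_enum: "inj enum"
begin

abbreviation segment :: "nat \<Rightarrow> 'x set" where
  "segment n \<equiv> enum ` {..<n}"

text \<open>A morphism \<open>(f, g)\<close> into \<open>segment n\<close> is recorded as the word of length \<open>n\<close> whose \<open>t\<close>-th letter
  is the preimage of the \<open>t\<close>-th point if there is one, and its colour otherwise. Composing with an
  order-preserving morphism only inserts colours, at places depending on that morphism alone, so
  it preserves the lexicographic order.\<close>

definition word :: "'x set \<Rightarrow> nat \<Rightarrow> ('x \<Rightarrow> 'x) \<times> ('x \<Rightarrow> nat) \<Rightarrow> ('x + nat) list" where
  "word S n = (\<lambda>(f, g). map (\<lambda>t. if enum t \<in> f ` S then Inl (the_inv_into S f (enum t))
     else Inr (g (enum t))) [0..<n])"

lemma length_word [simp]: "length (word S n \<phi>) = n"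
  by (simp add: word_def split: prod.splits)

lemma enum_eq_iff [simp]: "enum i = enum j \<longleftrightarrow> i = j"
  using inj_enum by (simp add: inj_eq)

lemma word_nth_Inl:
  assumes "(f, g) \<in> FI_hom d S (segment n)" "t < n"
  shows "word S n (f, g) ! t = Inl s \<longleftrightarrow> s \<in> S \<and> f s = enum t"
proof -
  have "inj_on f S"
    using assms by (auto simp: FI_hom_def)
  then have "enum t \<in> f ` S \<and> the_inv_into S f (enum t) = s \<longleftrightarrow> s \<in> S \<and> f s = enum t"
    by (metis f_the_inv_into_f image_eqI subset_refl the_inv_into_f_f the_inv_into_into)
  then show ?thesis
    using assms(2) by (auto simp: word_def)
qed

lemma word_nth_Inr:
  assumes "t < n"
  shows "word S n (f, g) ! t = Inr c \<longleftrightarrow> enum t \<notin> f ` S \<and> g (enum t) = c"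
  using assms by (auto simp: word_def)

lemma word_letters:
  assumes "\<phi> \<in> FI_hom d S (segment n)"
  shows "word S n \<phi> \<in> lists (Inl ` S \<union> Inr ` {1..d})"
proof -
  obtain f g where [simp]: "\<phi> = (f, g)"
    by (cases \<phi>)
  have f: "inj_on f S" "g \<in> (segment n - f ` S) \<rightarrow>\<^sub>E {1..d}"
    using assms by (auto simp: FI_hom_def)
  have "g (enum t) \<in> {1..d}" if "t < n" "enum t \<notin> f ` S" for t
    using PiE_mem[OF f(2), of "enum t"] that by auto
  then show ?thesis
    using f(1) by (auto simp: word_def the_inv_into_f_f)
qed

text \<open>The position of the letter \<open>Inl s\<close> gives the value at \<open>s\<close>, the
  other letters give the colours; off their domains both maps are fixed by extensionality.\<close>

lemma word_inject:
  assumes \<phi>: "\<phi> \<in> FI_hom d S (segment n)" and \<phi>': "\<phi>' \<in> FI_hom d S (segment n)"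
    and eq: "word S n \<phi> = word S n \<phi>'"
  shows "\<phi> = \<phi>'"
proof -
  obtain f g f' g' where [simp]: "\<phi> = (f, g)" "\<phi>' = (f', g')"
    by (cases \<phi>, cases \<phi>')
  have f: "f \<in> S \<rightarrow>\<^sub>E segment n" "g \<in> (segment n - f ` S) \<rightarrow>\<^sub>E {1..d}"
    and f': "f' \<in> S \<rightarrow>\<^sub>E segment n" "g' \<in> (segment n - f' ` S) \<rightarrow>\<^sub>E {1..d}"
    using assms(1,2) by (auto simp: FI_hom_def)
  have "f s = f' s" if s: "s \<in> S" for s
  proof -
    obtain t where "t < n" "f s = enum t"
      using PiE_mem[OF f(1) s] by auto
    then show ?thesis
      using eq word_nth_Inl[of f g d S n t s] word_nth_Inl[of f' g' d S n t s] \<phi> \<phi>' s by simp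
  qed
  then have [simp]: "f = f'"
    using PiE_ext[OF f(1) f'(1)] by blast
  have "g u = g' u" if u: "u \<in> segment n - f ` S" for u
  proof -
    obtain t where "t < n" "u = enum t"
      using u by auto
    then show ?thesis
      using eq word_nth_Inr[of t n S f g "g u"] word_nth_Inr[of t n S f' g' "g u"] u by simp
  qed
  then have "g = g'"
    using PiE_ext[OF f(2)] f'(2) by simp
  then show ?thesis by simp
qed

text \<open>\<open>c\<close> may be any function on points, since only its values at points missed
  by the embedding enter. In the application it is the colouring of the larger of two
  morphisms.\<close>

definition order_embedding ::
    "(nat \<Rightarrow> nat) \<Rightarrow> nat \<Rightarrow> nat \<Rightarrow> ('x \<Rightarrow> nat) \<Rightarrow> ('x \<Rightarrow> 'x) \<times> ('x \<Rightarrow> nat)" where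
  "order_embedding h m n c =
     (\<lambda>x\<in>segment m. enum (h (the_inv enum x)), \<lambda>x\<in>segment n - enum ` h ` {..<m}. c x)"

context
  fixes h :: "nat \<Rightarrow> nat" and m n d :: nat and c :: "'x \<Rightarrow> nat"
  assumes h: "strict_mono h" "\<And>i. i < m \<Longrightarrow> h i < n"
    and c: "\<And>t. t < n \<Longrightarrow> t \<notin> h ` {..<m} \<Longrightarrow> c (enum t) \<in> {1..d}"
begin

private lemma fst_order_embedding [simp]:
  "i < m \<Longrightarrow> fst (order_embedding h m n c) (enum i) = enum (h i)"
  by (simp add: order_embedding_def the_inv_f_f inj_enum)

private lemma image_order_embedding:
  "fst (order_embedding h m n c) ` segment m = enum ` h ` {..<m}"
  by (force simp: image_image)

private lemma inj_order_embedding: "inj_on (fst (order_embedding h m n c)) (segment m)"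
  using h(1) by (auto simp: inj_on_def strict_mono_eq)

lemma order_embedding_hom: "order_embedding h m n c \<in> FI_hom d (segment m) (segment n)"
proof -
  have "fst (order_embedding h m n c) \<in> segment m \<rightarrow>\<^sub>E segment n"
    using h(2) by (auto simp: order_embedding_def the_inv_f_f inj_enum)
  moreover have "snd (order_embedding h m n c) \<in> (segment n - enum ` h ` {..<m}) \<rightarrow>\<^sub>E {1..d}"
    unfolding order_embedding_def snd_conv using c by (intro restrict_PiE_iff[THEN iffD2]) auto
  ultimately show ?thesis
    using inj_order_embedding image_order_embedding by (auto simp: FI_hom_def split_beta)
qed

lemma word_order_embedding_comp:
  assumes \<chi>: "\<chi> \<in> FI_hom d T (segment m)" and t: "t < n"
  shows "word T n (FI_comp T (segment m) (segment n) (order_embedding h m n c) \<chi>) ! t =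
    (if t \<in> h ` {..<m} then word T m \<chi> ! the_inv h t else Inr (c (enum t)))"
proof -
  obtain f g where [simp]: "\<chi> = (f, g)"
    by (cases \<chi>)
  define p where "p = fst (order_embedding h m n c)"
  obtain F G where FG: "FI_comp T (segment m) (segment n) (order_embedding h m n c) \<chi> = (F, G)"
    by force
  then have F: "F = compose T p f"
    and G: "G = (\<lambda>u\<in>segment n - p ` f ` T. if u \<in> p ` segment m
        then g (the_inv_into (segment m) p u) else snd (order_embedding h m n c) u)"
    by (auto simp: FI_comp_def p_def split_beta)
  have FG_hom: "(F, G) \<in> FI_hom d T (segment n)"
    using FI_comp_closed[OF \<chi> order_embedding_hom] FG by simp
  have f: "\<And>s. s \<in> T \<Longrightarrow> f s \<in> segment m"
    using \<chi> by (auto simp: FI_hom_def)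
  have inj_p: "inj_on p (segment m)" and p: "\<And>i. i < m \<Longrightarrow> p (enum i) = enum (h i)"
    and im_p: "p ` segment m = enum ` h ` {..<m}"
    using inj_order_embedding image_order_embedding by (auto simp: p_def)
  have inj_h: "inj h"
    using h(1) by (rule strict_mono_imp_inj_on)
  have F_image: "F ` T = p ` f ` T"
    by (auto simp: F compose_def)
  show ?thesis
  proof (cases "t \<in> h ` {..<m}")
    case True
    then obtain i where i: "i < m" "t = h i" by auto
    have "word T n (F, G) ! t = word T m \<chi> ! i"
    proof (cases "word T m \<chi> ! i")
      case (Inl s)
      then have "s \<in> T" "f s = enum i"
        using word_nth_Inl \<chi> i(1) by auto
      then have "F s = enum t"
        by (simp add: F compose_def p i)
      then show ?thesis
        using word_nth_Inl[OF FG_hom t] Inl \<open>s \<in> T\<close> by simp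
    next
      case (Inr a)
      then have a: "enum i \<notin> f ` T" "g (enum i) = a"
        using word_nth_Inr i(1) by auto
      have *: "enum t = p (enum i)" and mem: "enum i \<in> segment m"
        using i by (auto simp: p)
      have notin: "enum t \<notin> p ` f ` T"
      proof
        assume "enum t \<in> p ` f ` T"
        then obtain s where s: "s \<in> T" "p (enum i) = p (f s)"
          unfolding * by auto
        then have "enum i = f s"
          using inj_onD[OF inj_p s(2) mem f[OF s(1)]] by simp
        then show False
          using a(1) s(1) by auto
      qed
      have "the_inv_into (segment m) p (enum t) = enum i"
        unfolding * by (rule the_inv_into_f_f[OF inj_p mem])
      moreover have "enum t \<in> p ` segment m"
        unfolding * using mem by (rule imageI)
      moreover have "enum t \<in> segment n"
        using t by simp
      ultimately have "G (enum t) = a"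
        using a(2) notin by (simp add: G)
      then show ?thesis
        using word_nth_Inr[OF t] Inr notin by (simp add: F_image)
    qed
    then show ?thesis
      using True i FG the_inv_f_f[OF inj_h] by simp
  next
    case False
    then have notin: "enum t \<notin> p ` segment m"
      by (auto simp: im_p)
    then have "enum t \<notin> p ` f ` T"
      using f by auto
    moreover have "enum t \<in> segment n - enum ` h ` {..<m}"
      using t False by auto
    ultimately have "enum t \<notin> F ` T" "G (enum t) = c (enum t)"
      using notin by (simp_all add: F_image G) (simp add: order_embedding_def)
    then show ?thesis
      using word_nth_Inr[OF t] False FG by simp
  qed
qed

text \<open>The first difference moves from position \<open>i\<close> to \<open>h i\<close>: an
  earlier position is either \<open>h l\<close> with \<open>l < i\<close>, where the words agree, or
  carries a colour from \<open>c\<close> that is the same in both.\<close>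

lemma order_embedding_lex_mono:
  assumes \<chi>: "\<chi> \<in> FI_hom d T (segment m)" and \<chi>': "\<chi>' \<in> FI_hom d T (segment m)"
    and lex: "(word T m \<chi>, word T m \<chi>') \<in> lex r"
  shows "(word T n (FI_comp T (segment m) (segment n) (order_embedding h m n c) \<chi>),
    word T n (FI_comp T (segment m) (segment n) (order_embedding h m n c) \<chi>')) \<in> lex r"
    (is "(?w, ?w') \<in> _")
proof -
  have inj_h: "inj h"
    using h(1) by (rule strict_mono_imp_inj_on)
  have w: "?w ! h l = word T m \<chi> ! l" "?w' ! h l = word T m \<chi>' ! l" if "l < m" for l
    using word_order_embedding_comp[of _ T "h l"] \<chi> \<chi>' h(2)[OF that] that
    by (auto simp: the_inv_f_f inj_h)
  obtain i where i: "i < m" "\<forall>j<i. word T m \<chi> ! j = word T m \<chi>' ! j"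
      "(word T m \<chi> ! i, word T m \<chi>' ! i) \<in> r"
    using lex by (auto simp: lex_iff_nth)
  have "?w ! j = ?w' ! j" if "j < h i" for j
  proof (cases "j \<in> h ` {..<m}")
    case True
    then obtain l where "l < m" "j = h l" by auto
    moreover from this have "l < i"
      using that h(1) by (simp add: strict_mono_less)
    ultimately show ?thesis
      using w i(2) by simp
  next
    case False
    then show ?thesis
      using word_order_embedding_comp[OF \<chi>, of j] word_order_embedding_comp[OF \<chi>', of j]
        that h(2)[OF i(1)] by simp
  qed
  then show ?thesis
    using w[OF i(1)] i(3) h(2)[OF i(1)] by (auto simp: lex_iff_nth)
qed

end

text \<open>Every element of \<open>S\<close> occurs exactly once in the word of a morphism from
  \<open>S\<close>. The embedded copy of the smaller word already contains them all, so the letters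
  outside it are colours, and these colour the points missed by the factor.\<close>

lemma subseq_word_factor:
  assumes \<phi>: "\<phi> \<in> FI_hom d S (segment m)" and \<phi>': "\<phi>' \<in> FI_hom d S (segment n)"
    and sub: "subseq (word S m \<phi>) (word S n \<phi>')"
  obtains \<psi> where "\<psi> \<in> FI_hom d (segment m) (segment n)"
    "FI_comp S (segment m) (segment n) \<psi> \<phi> = \<phi>'"
    "\<And>T \<chi> \<chi>'. \<lbrakk>\<chi> \<in> FI_hom d T (segment m); \<chi>' \<in> FI_hom d T (segment m);
        (word T m \<chi>, word T m \<chi>') \<in> lex r\<rbrakk> \<Longrightarrow>
      (word T n (FI_comp T (segment m) (segment n) \<psi> \<chi>),
       word T n (FI_comp T (segment m) (segment n) \<psi> \<chi>')) \<in> lex r"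
proof -
  obtain h where h: "strict_mono h" "\<And>i. i < m \<Longrightarrow> h i < n"
    and word_h: "\<And>i. i < m \<Longrightarrow> word S n \<phi>' ! h i = word S m \<phi> ! i"
    using subseq_nth_embedding[OF sub] unfolding length_word by metis
  obtain f g f' g' where [simp]: "\<phi> = (f, g)" "\<phi>' = (f', g')"
    by (cases \<phi>, cases \<phi>')
  have notin: "enum t \<notin> f' ` S" if t: "t < n" "t \<notin> h ` {..<m}" for t
  proof
    assume "enum t \<in> f' ` S"
    then obtain s where s: "s \<in> S" "f' s = enum t" by auto
    have "f s \<in> segment m"
      using \<phi> s(1) by (auto simp: FI_hom_def)
    then obtain i where i: "i < m" "f s = enum i" by auto
    then have "word S n \<phi>' ! h i = Inl s"
      using word_h[OF i(1)] word_nth_Inl[of f g d S m i s] \<phi> s(1) by simp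
    then have "f' s = enum (h i)"
      using word_nth_Inl[of f' g' d S n "h i" s] \<phi>' h(2)[OF i(1)] by simp
    then show False
      using s(2) t(2) i(1) by auto
  qed
  have c: "g' (enum t) \<in> {1..d}" if "t < n" "t \<notin> h ` {..<m}" for t
  proof -
    have "g' \<in> (segment n - f' ` S) \<rightarrow>\<^sub>E {1..d}"
      using \<phi>' by (simp add: FI_hom_def)
    then show ?thesis
      using that notin[OF that] by (auto dest: PiE_mem)
  qed
  let ?\<psi> = "order_embedding h m n g'"
  have hom: "?\<psi> \<in> FI_hom d (segment m) (segment n)"
    using h c by (rule order_embedding_hom)
  \<comment> \<open>The morphisms are compared through their words: on the range of \<open>h\<close>
    the letters agree by the embedding, elsewhere both show the colour given by
    \<open>g'\<close>.\<close>
  have "FI_comp S (segment m) (segment n) ?\<psi> \<phi> = \<phi>'"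
  proof (rule word_inject[OF FI_comp_closed[OF \<phi> hom] \<phi>'], rule nth_equalityI)
    fix t
    assume "t < length (word S n (FI_comp S (segment m) (segment n) ?\<psi> \<phi>))"
    then have t: "t < n" by simp
    show "word S n (FI_comp S (segment m) (segment n) ?\<psi> \<phi>) ! t = word S n \<phi>' ! t"
    proof (cases "t \<in> h ` {..<m}")
      case True
      then show ?thesis
        using word_order_embedding_comp[where h = h and c = g', OF h c \<phi> t] word_h
        by (auto simp: the_inv_f_f strict_mono_imp_inj_on[OF h(1)])
    next
      case False
      then show ?thesis
        using word_order_embedding_comp[where h = h and c = g', OF h c \<phi> t] word_nth_Inr[OF t, of S f' g' "g' (enum t)"] notin[OF t]
        by simp
    qed
  qed simp
  then show thesis
    using that[OF hom] order_embedding_lex_mono[where h = h and c = g', OF h c] by blast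
qed

end

section \<open>The Groebner conditions for \<open>FI d\<close>\<close>

text \<open>The objectwise spans of these images form a subrepresentation, because composites of
  morphisms are morphisms, and contain the generators through the identities. Minimality does the
  rest.\<close>

lemma (in representation) carrier_subset_span_generators:
  assumes A: "A \<subseteq> rep_elements C M" and gen: "smallest_subrep R C M A (\<lambda>x. carrier (ObjMap M x))"
    and x: "x \<in> Obj C"
  shows "carrier (ObjMap M x) \<subseteq> submodule_span R (ObjMap M x)
    {ArrMap M y x f v |y v f. (y, v) \<in> A \<and> f \<in> Hom C y x}"
proof -
  define G where "G x = {ArrMap M y x f v |y v f. (y, v) \<in> A \<and> f \<in> Hom C y x}" for x
  have A_closed: "y \<in> Obj C" "v \<in> carrier (ObjMap M y)" if "(y, v) \<in> A" for y v
    using A that by (auto simp: rep_elements_def)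
  have ArrMap_closed: "ArrMap M y z f v \<in> carrier (ObjMap M z)"
    if "y \<in> Obj C" "z \<in> Obj C" "f \<in> Hom C y z" "v \<in> carrier (ObjMap M y)" for y z f v
    using subrep_ArrMap[OF subrep_carrier that] .
  have G_closed: "G z \<subseteq> carrier (ObjMap M z)" if "z \<in> Obj C" for z
    using ArrMap_closed A_closed that by (auto simp: G_def)
  let ?N = "\<lambda>z. submodule_span R (ObjMap M z) (G z)"
  have "subrep R C M ?N"
    unfolding subrep_def
  proof (intro conjI ballI)
    fix z
    assume "z \<in> Obj C"
    then show "submodule (?N z) R (ObjMap M z)"
      using submodule_span_submodule[OF ObjMap_module G_closed] by blast
  next
    fix y z f
    assume yzf: "y \<in> Obj C" "z \<in> Obj C" "f \<in> Hom C y z"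
    have "G y \<subseteq> {u \<in> carrier (ObjMap M y). ArrMap M y z f u \<in> ?N z}"
    proof
      fix u
      assume u: "u \<in> G y"
      then obtain w v g where w: "(w, v) \<in> A" "g \<in> Hom C w y" "u = ArrMap M w y g v"
        by (auto simp: G_def)
      then have "ArrMap M y z f u = ArrMap M w z (Comp C w y z f g) v"
        using ArrMap_Comp A_closed yzf by simp
      moreover have "Comp C w y z f g \<in> Hom C w z"
        using Comp_closed A_closed(1) w yzf by blast
      ultimately have "ArrMap M y z f u \<in> G z"
        using w(1) unfolding G_def by blast
      then show "u \<in> {u \<in> carrier (ObjMap M y). ArrMap M y z f u \<in> ?N z}"
        using u G_closed[OF yzf(1)] submodule_span_superset by fastforce
    qed
    then have "?N y \<subseteq> {u \<in> carrier (ObjMap M y). ArrMap M y z f u \<in> ?N z}"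
      by (intro submodule_span_minimal submodule_vimage[OF ObjMap_module ObjMap_module ArrMap_hom]
          submodule_span_submodule ObjMap_module G_closed yzf)
    then show "ArrMap M y z f ` ?N y \<subseteq> ?N z"
      by auto
  qed
  moreover have "v \<in> ?N y" if "(y, v) \<in> A" for y v
  proof -
    have "ArrMap M y y (Ident C y) v = v" "Ident C y \<in> Hom C y y"
      using ArrMap_Ident Ident_closed A_closed[OF that] by simp_all
    then have "v \<in> G y"
      using that unfolding G_def by force
    then show ?thesis
      by (rule subsetD[OF submodule_span_superset])
  qed
  ultimately have "carrier (ObjMap M x) \<subseteq> ?N x"
    using gen x unfolding smallest_subrep_def by blast
  then show ?thesis
    by (simp add: G_def)
qed

text \<open>A bijection misses no point, so the empty colouring completes it in both directions. The
  one composite suffices to retract an object onto a segment.\<close>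

lemma FI_iso_of_bij:
  assumes bij: "bij_betw f S T"
  shows "\<exists>\<phi>\<in>FI_hom d S T. \<exists>\<psi>\<in>FI_hom d T S.
    FI_comp S T S \<psi> \<phi> = (\<lambda>s\<in>S. s, \<lambda>_\<in>{}. undefined)"
proof (intro bexI)
  let ?f = "restrict f S" and ?g = "restrict (the_inv_into S f) T"
  let ?c = "\<lambda>_\<in>{}. undefined :: nat"
  have f: "f ` S = T" "inj_on f S"
    using bij by (auto simp: bij_betw_def)
  have g: "the_inv_into S f ` T = S" "inj_on (the_inv_into S f) T"
    using bij_betw_the_inv_into[OF bij] by (auto simp: bij_betw_def)
  have im: "?f ` S = T" "?g ` T = S"
    using f g by auto
  show "(?f, ?c) \<in> FI_hom d S T"
    using f by (auto simp: FI_hom_def inj_on_def)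
  show "(?g, ?c) \<in> FI_hom d T S"
    using g by (auto simp: FI_hom_def inj_on_def)
  have "compose S ?g ?f = (\<lambda>s\<in>S. s)"
    using f by (auto simp: compose_def fun_eq_iff the_inv_into_f_f)
  moreover have "restrict F {} = (\<lambda>_. undefined)" for F :: "'a \<Rightarrow> nat"
    by (simp add: restrict_def)
  ultimately show "FI_comp S T S (?g, ?c) (?f, ?c) = (\<lambda>s\<in>S. s, \<lambda>_\<in>{}. undefined)"
    by (simp only: FI_comp_def prod.case im Diff_cancel)
qed

theorem corollary7p1p5:
  fixes R :: "('k, 'r) ring_scheme" and d :: nat
  assumes "d > 0"
    and "left_noetherian_ring R"
  shows "Rep_noetherian R
           (FI d :: ('x::infinite set, ('x \<Rightarrow> 'x) \<times> ('x \<Rightarrow> nat)) category) TYPE('m)"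
  unfolding Rep_noetherian_def
proof (intro allI impI)
  fix M :: "('x set, ('x \<Rightarrow> 'x) \<times> ('x \<Rightarrow> nat), 'k, 'm) rep" and N :: "'x set \<Rightarrow> 'm set"
  assume M: "representation R (FI d) M \<and> finitely_generated_rep R (FI d) M"
    and N: "subrep R (FI d) M N"
  interpret representation R "FI d" M
    using M by blast
  obtain A where A: "finite A" "A \<subseteq> rep_elements (FI d) M"
      "smallest_subrep R (FI d) M A (\<lambda>x. carrier (ObjMap M x))"
    using M unfolding finitely_generated_rep_def by blast
  \<comment> \<open>An injective sequence provides an ordered object of every finite size, although
    the type of points has no order.\<close>
  obtain enum :: "nat \<Rightarrow> 'x" where enum: "inj enum"
    using infinite_countable_subset[OF infinite_UNIV] by blast
  obtain rA :: "(('x set \<times> 'm) \<times> ('x set \<times> 'm)) set" where rA: "wf rA" "trans rA" "total rA"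
    using ex_wf_trans_total by blast
  obtain r :: "(('x + nat) \<times> ('x + nat)) set" where r: "wf r" "trans r" "total r"
    using ex_wf_trans_total by blast
  let ?seg = "\<lambda>n. enum ` {..<n}"
  \<comment> \<open>The index remembers generator and morphism, not just the vector they yield, so
    distinct indices may have the same \<open>e\<close>.\<close>
  define I where "I = {(a, n, \<phi>). a \<in> A \<and> \<phi> \<in> FI_hom d (fst a) (?seg n)}"
  define ob where "ob = (\<lambda>(a :: 'x set \<times> 'm, n :: nat, \<phi> :: ('x \<Rightarrow> 'x) \<times> ('x \<Rightarrow> nat)). ?seg n)"
  define e where "e = (\<lambda>(a, n, \<phi>). ArrMap M (fst a) (?seg n) \<phi> (snd a))"
  define wd where "wd = (\<lambda>(a :: 'x set \<times> 'm, n, \<phi>). word enum (fst a) n \<phi>)"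
  \<comment> \<open>Generators are compared first, then words. Unlike the dictionary order,
    \<open>lex\<close> relates only words of equal length and so stays well-founded. Words at one
    object do have equal length, which gives totality object by object.\<close>
  define lt where "lt = inv_image (rA <*lex*> lex r) (\<lambda>i. (fst i, wd i))"
  \<comment> \<open>Comparison stays within one generator: the factor then turns the morphism of
    \<open>i\<close> into that of \<open>j\<close> on the same vector, and so sends
    \<open>e i\<close> to \<open>e j\<close>.\<close>
  define le where "le i j \<longleftrightarrow> fst i = fst j \<and> subseq (wd i) (wd j)" for i j
  have seg_eq: "?seg m = ?seg n \<longleftrightarrow> m = n" for m n
    using enum by (simp add: inj_image_eq_iff)
  have A_obj: "finite (fst a)" "snd a \<in> carrier (ObjMap M (fst a))" if "a \<in> A" for a
    using A(2) that by (auto simp: rep_elements_def FI_def)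
  have Hom: "Hom (FI d) = FI_hom d" and Obj: "Obj (FI d) = Collect finite"
    and Comp: "Comp (FI d) = FI_comp" for d
    by (simp_all add: FI_def)
  have e_closed: "e i \<in> carrier (ObjMap M (ob i))" if "i \<in> I" for i
    using that subrep_ArrMap[OF subrep_carrier] A_obj
    by (auto simp: I_def e_def ob_def Hom Obj)
  show "finitely_generated_rep R (FI d) (restrict_rep M N)"
  proof (rule finitely_generated_restrict_rep_if_Groebner[where I = I and ob = ob and e = e
        and lt = lt and le = le and D = "range ?seg"])
    show "left_noetherian_ring R" "subrep R (FI d) M N"
      by fact+
    show "ob i \<in> Obj (FI d) \<and> e i \<in> carrier (ObjMap M (ob i))" if "i \<in> I" for i
      using e_closed[OF that] by (auto simp: ob_def Obj split: prod.splits)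
    show "wf lt"
      unfolding lt_def by (intro wf_inv_image wf_lex_prod wf_lex rA r)
    show "trans lt"
      unfolding lt_def by (intro trans_inv_image trans_lex_prod lex_transI rA r)
    show "total_on {i \<in> I. ob i = x} lt" for x
    proof (rule total_onI)
      fix i j
      assume "i \<in> {i \<in> I. ob i = x}" "j \<in> {i \<in> I. ob i = x}" and "i \<noteq> j"
      moreover obtain a m \<phi> b n \<psi> where [simp]: "i = (a, m, \<phi>)" "j = (b, n, \<psi>)"
        by (metis prod_cases3)
      ultimately have ij: "\<phi> \<in> FI_hom d (fst a) (?seg n)" "\<psi> \<in> FI_hom d (fst b) (?seg n)"
          "m = n" "a \<noteq> b \<or> \<phi> \<noteq> \<psi>"
        by (auto simp: I_def ob_def seg_eq)
      show "(i, j) \<in> lt \<or> (j, i) \<in> lt"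
      proof (cases "a = b")
        case True
        then have "wd i \<noteq> wd j"
          using word_inject[OF enum, of \<phi> d "fst b" n \<psi>] ij by (auto simp: wd_def)
        then show ?thesis
          using lex_linear[OF r(3), of "wd i" "wd j"] True \<open>m = n\<close>
          by (auto simp: lt_def wd_def length_word[OF enum])
      next
        case False
        then have "(a, b) \<in> rA \<or> (b, a) \<in> rA"
          using rA(3) unfolding total_on_def by blast
        then show ?thesis
          by (auto simp: lt_def)
      qed
    qed
    show "\<exists>f\<in>Hom (FI d) (ob i) (ob j). ArrMap M (ob i) (ob j) f (e i) = e j \<and>
        (\<forall>i'\<in>I. ob i' = ob i \<and> (i', i) \<in> lt \<longrightarrow>
          (\<exists>j'\<in>I. ob j' = ob j \<and> (j', j) \<in> lt \<and> ArrMap M (ob i) (ob j) f (e i') = e j'))"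
      if ij: "i \<in> I" "j \<in> I" "le i j" for i j
    proof -
      obtain a m \<phi> n \<phi>' where i: "i = (a, m, \<phi>)" and j: "j = (a, n, \<phi>')"
        using ij(3) by (cases i; cases j) (auto simp: le_def)
      then have \<phi>: "\<phi> \<in> FI_hom d (fst a) (?seg m)" "\<phi>' \<in> FI_hom d (fst a) (?seg n)" "a \<in> A"
        and sub: "subseq (word enum (fst a) m \<phi>) (word enum (fst a) n \<phi>')"
        using ij by (auto simp: I_def le_def wd_def)
      obtain \<psi> where \<psi>: "\<psi> \<in> FI_hom d (?seg m) (?seg n)"
        "FI_comp (fst a) (?seg m) (?seg n) \<psi> \<phi> = \<phi>'"
        and mono: "\<And>T \<chi> \<chi>'. \<lbrakk>\<chi> \<in> FI_hom d T (?seg m); \<chi>' \<in> FI_hom d T (?seg m);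
            (word enum T m \<chi>, word enum T m \<chi>') \<in> lex r\<rbrakk> \<Longrightarrow>
          (word enum T n (FI_comp T (?seg m) (?seg n) \<psi> \<chi>),
           word enum T n (FI_comp T (?seg m) (?seg n) \<psi> \<chi>')) \<in> lex r"
        using subseq_word_factor[OF enum \<phi>(1,2) sub, of r] by blast
      have push: "ArrMap M (?seg m) (?seg n) \<psi> (e (b, m, \<chi>)) =
          e (b, n, FI_comp (fst b) (?seg m) (?seg n) \<psi> \<chi>)" if "(b, m, \<chi>) \<in> I" for b \<chi>
        using that ArrMap_Comp[of "fst b" "?seg m" "?seg n" \<chi> \<psi> "snd b"] A_obj[of b] \<psi>(1)
        by (auto simp: I_def e_def Hom Obj Comp)
      have "\<exists>j'\<in>I. ob j' = ob j \<and> (j', j) \<in> lt \<and> ArrMap M (ob i) (ob j) \<psi> (e i') = e j'"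
        if i': "i' \<in> I" "ob i' = ob i" "(i', i) \<in> lt" for i'
      proof -
        obtain b \<chi> where i'_eq: "i' = (b, m, \<chi>)"
          using i'(2) by (cases i') (auto simp: ob_def i seg_eq)
        have \<chi>: "b \<in> A" "\<chi> \<in> FI_hom d (fst b) (?seg m)"
          using i'(1) by (auto simp: I_def i'_eq)
        let ?j' = "(b, n, FI_comp (fst b) (?seg m) (?seg n) \<psi> \<chi>)"
        have "?j' \<in> I"
          using \<chi> FI_comp_closed[OF \<chi>(2) \<psi>(1)] by (simp add: I_def)
        \<comment> \<open>Composing with \<open>\<psi>\<close> does not change the generator. A
          strict comparison of generators thus persists, and for equal generators
          \<open>mono\<close> applies.\<close>
        moreover have "(?j', j) \<in> lt"
          using i'(3) mono[of \<chi> "fst a" \<phi>] \<chi>(2) \<phi>(1) \<psi>(2)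
          by (auto simp: lt_def wd_def i'_eq i j)
        ultimately show ?thesis
          using push[of b \<chi>] i'(1) by (intro bexI[of _ ?j']) (auto simp: ob_def i j i'_eq)
      qed
      then show ?thesis
        using \<psi> push[of a \<phi>] ij(1) by (intro bexI[of _ \<psi>]) (auto simp: ob_def i j Hom)
    qed
    show "\<exists>k :: nat \<Rightarrow> nat. strict_mono k \<and> (\<forall>l m. l < m \<longrightarrow> le (s (k l)) (s (k m)))"
      if s: "range s \<subseteq> I" for s :: "nat \<Rightarrow> ('x set \<times> 'm) \<times> nat \<times> ('x \<Rightarrow> 'x) \<times> ('x \<Rightarrow> nat)"
    proof -
      have "fst i \<in> A" if "i \<in> I" for i
        using that by (auto simp: I_def)
      then have "range (fst \<circ> s) \<subseteq> A"
        using s unfolding image_comp[symmetric] by blast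
      \<comment> \<open>First pass to a single generator, of which there are finitely many; then all
        words use one finite alphabet and Higman's lemma applies.\<close>
      then obtain k1 :: "nat \<Rightarrow> nat" and a where k1: "strict_mono k1" "\<And>n. (fst \<circ> s) (k1 n) = a"
        by (rule infinite_sequence_constant_subsequence[OF A(1)]) blast
      have s_k1: "s (k1 n) \<in> I" for n
        using s by blast
      have "wd (s (k1 n)) \<in> lists (Inl ` fst a \<union> Inr ` {1..d})" for n
        using s_k1[of n] k1(2)[of n] word_letters[OF enum]
        by (cases "s (k1 n)") (auto simp: I_def wd_def simp del: in_lists_conv_set)
      then have "range (\<lambda>n. wd (s (k1 n))) \<subseteq> lists (Inl ` fst a \<union> Inr ` {1..d})"
        by blast
      moreover have "a \<in> A"
        using k1(2)[of 0] s_k1[of 0] by (auto simp: I_def)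
      then have "finite (Inl ` fst a \<union> Inr ` {1..d})"
        using A_obj(1) by simp
      ultimately obtain k2 :: "nat \<Rightarrow> nat" where k2: "strict_mono k2"
          "\<And>l m. l < m \<Longrightarrow> subseq (wd (s (k1 (k2 l)))) (wd (s (k1 (k2 m))))"
        using Higman_finite_alphabet_chain[of _ "\<lambda>n. wd (s (k1 n))"] by metis
      show ?thesis
        using k1 k2 by (intro exI[of _ "k1 \<circ> k2"]) (auto simp: le_def strict_mono_o)
    qed
    show "range ?seg \<subseteq> Obj (FI d)"
      by (auto simp: Obj)
    show "carrier (ObjMap M x) \<subseteq> submodule_span R (ObjMap M x) (e ` {i \<in> I. ob i = x})"
      if x_seg: "x \<in> range ?seg" for x
    proof -
      obtain n where x: "x = ?seg n"
        using x_seg by blast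
      have "{ArrMap M y x f v |y v f. (y, v) \<in> A \<and> f \<in> Hom (FI d) y x} \<subseteq> e ` {i \<in> I. ob i = x}"
      proof
        fix u
        assume "u \<in> {ArrMap M y x f v |y v f. (y, v) \<in> A \<and> f \<in> Hom (FI d) y x}"
        then obtain y v f where "u = e ((y, v), n, f)" "((y, v), n, f) \<in> {i \<in> I. ob i = x}"
          by (auto simp: I_def ob_def e_def Hom x)
        then show "u \<in> e ` {i \<in> I. ob i = x}"
          by (rule image_eqI)
      qed
      from submodule_span_mono[OF this] show ?thesis
        using carrier_subset_span_generators[OF A(2,3), of x] by (auto simp: x Obj)
    qed
    show "\<exists>x\<in>range ?seg. \<exists>f\<in>Hom (FI d) y x. \<exists>g\<in>Hom (FI d) x y.
        Comp (FI d) y x y g f = Ident (FI d) y" if "y \<in> Obj (FI d)" for y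
    proof -
      have "\<exists>f. bij_betw f y (?seg (card y))"
        using that enum by (intro finite_same_card_bij) (auto simp: Obj card_image inj_on_subset)
      then obtain f where "bij_betw f y (?seg (card y))" ..
      from FI_iso_of_bij[OF this, of d] show ?thesis
        unfolding Hom Comp by (intro bexI[of _ "?seg (card y)"]) (simp_all add: FI_def)
    qed
  qed
qed

end
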